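(* Let $M$ be a smooth closed manifold of dimension $m \geq 2$ and let $f : M \to \mathbb{R}$ be a smooth function. If $f$ has at most finitely many critical values, then the Reeb space $W_f$ has the structure of a graph. Furthermore, the Reeb map $\bar{f} : W_f \to \mathbb{R}$ is an embedding on each edge.
   Context: Smooth means of class $C^\infty$. A manifold is closed if it is compact and has no boundary (it is not assumed to be connected). A critical value of $f$ is the image $f(x)$ of a critical point $x$ of $f$. Reeb space: for a continuous map $f : X \to Y$ between topological spaces and $x_0, x_1 \in X$, write $x_0 \sim x_1$ if $f(x_0) = f(x_1)$ and $x_0, x_1$ lie on the same connected component of $f^{-1}(f(x_0)) = f^{-1}(f(x_1))$. The Reeb space $W_f = X/\!\sim$ is the quotient space with the quotient topology, $q_f : X \to W_f$ is the quotient map, and the Reeb map $\bar{f} : W_f \to Y$ is the unique continuous map with $f = \bar{f} \circ q_f$. A graph means a finite multigraph, which may contain multi-edges and/or loops; as a topological space it is a compact CW complex of dimension at most $1$ (isolated vertices are allowed). An edge is here understood together with its end points; in particular, the embedding property on an edge implies that the edge is not a loop. *)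

theory Defs
  imports "HOL-Analysis.Analysis"
begin

text \<open>
  Meaningful for open \<^term>\<open>S\<close> only: the derivatives are taken with respect to \<^term>\<open>at x\<close>.
  The domain being finite-dimensional, a map is of class $C^{k+1}$ iff it is differentiable and
  all its directional derivatives are of class $C^k$.
\<close>

primrec Ck_on :: "nat \<Rightarrow> 'a::euclidean_space set \<Rightarrow> ('a \<Rightarrow> 'b::euclidean_space) \<Rightarrow> bool" where
  "Ck_on 0 S f \<longleftrightarrow> continuous_on S f"
| "Ck_on (Suc k) S f \<longleftrightarrow>
     (\<forall>x\<in>S. f differentiable (at x)) \<and> (\<forall>v. Ck_on k S (\<lambda>x. frechet_derivative f (at x) v))"

definition smooth_on :: "'a::euclidean_space set \<Rightarrow> ('a \<Rightarrow> 'b::euclidean_space) \<Rightarrow> bool" where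
  "smooth_on S f \<longleftrightarrow> (\<forall>k. Ck_on k S f)"

text \<open>
  A manifold is a topological space \<^term>\<open>X\<close> with a smooth atlas \<^term>\<open>A\<close>, not necessarily maximal.
  A chart is a pair of its domain and its coordinate map; coordinates lie in a Euclidean
  space \<^typ>\<open>'e\<close>, so the dimension is \<^term>\<open>DIM('e::euclidean_space)\<close>. As chart images are open
  in \<^typ>\<open>'e\<close>, there is no boundary.
\<close>

type_synonym ('a, 'e) chart = "'a set \<times> ('a \<Rightarrow> 'e)"

definition euclidean_chart :: "'a topology \<Rightarrow> ('a, 'e::euclidean_space) chart \<Rightarrow> bool" where
  "euclidean_chart X = (\<lambda>(U, \<phi>).
     openin X U \<and> open (\<phi> ` U) \<and> homeomorphic_map (subtopology X U) (top_of_set (\<phi> ` U)) \<phi>)"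

definition smooth_manifold :: "'a topology \<Rightarrow> ('a, 'e::euclidean_space) chart set \<Rightarrow> bool" where
  "smooth_manifold X A \<longleftrightarrow>
     Hausdorff_space X \<and> second_countable X \<and>
     (\<forall>c\<in>A. euclidean_chart X c) \<and>
     topspace X = (\<Union>(U, \<phi>)\<in>A. U) \<and>
     (\<forall>(U, \<phi>)\<in>A. \<forall>(V, \<psi>)\<in>A. smooth_on (\<phi> ` (U \<inter> V)) (\<psi> \<circ> inv_into U \<phi>))"

definition smooth_closed_manifold :: "'a topology \<Rightarrow> ('a, 'e::euclidean_space) chart set \<Rightarrow> bool" where
  "smooth_closed_manifold X A \<longleftrightarrow> smooth_manifold X A \<and> compact_space X"

definition smooth_function :: "('a, 'e::euclidean_space) chart set \<Rightarrow> ('a \<Rightarrow> real) \<Rightarrow> bool" where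
  "smooth_function A f \<longleftrightarrow> (\<forall>(U, \<phi>)\<in>A. smooth_on (\<phi> ` U) (f \<circ> inv_into U \<phi>))"

text \<open>
  By the chain rule, vanishing of the differential at \<^term>\<open>x\<close> does not depend on the chart around
  \<^term>\<open>x\<close> in which it is tested.
\<close>

definition critical_points ::
    "('a, 'e::euclidean_space) chart set \<Rightarrow> ('a \<Rightarrow> real) \<Rightarrow> 'a set" where
  "critical_points A f =
     {x. \<exists>(U, \<phi>)\<in>A. x \<in> U \<and> ((f \<circ> inv_into U \<phi>) has_derivative (\<lambda>_. 0)) (at (\<phi> x))}"

definition critical_values ::
    "('a, 'e::euclidean_space) chart set \<Rightarrow> ('a \<Rightarrow> real) \<Rightarrow> real set" where
  "critical_values A f = f ` critical_points A f"

definition quotient_topology :: "'a topology \<Rightarrow> ('a \<Rightarrow> 'b) \<Rightarrow> 'b topology" where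
  "quotient_topology X q =
     topology (\<lambda>U. U \<subseteq> q ` topspace X \<and> openin X {x \<in> topspace X. q x \<in> U})"

lemma openin_quotient_topology:
  "openin (quotient_topology X q) U \<longleftrightarrow>
     U \<subseteq> q ` topspace X \<and> openin X {x \<in> topspace X. q x \<in> U}"
proof -
  have "istopology (\<lambda>U. U \<subseteq> q ` topspace X \<and> openin X {x \<in> topspace X. q x \<in> U})"
    unfolding istopology_def
  proof (intro conjI allI impI)
    fix S T
    assume S: "S \<subseteq> q ` topspace X \<and> openin X {x \<in> topspace X. q x \<in> S}"
      and T: "T \<subseteq> q ` topspace X \<and> openin X {x \<in> topspace X. q x \<in> T}"
    show "S \<inter> T \<subseteq> q ` topspace X" using S by blast
    have "{x \<in> topspace X. q x \<in> S \<inter> T} =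
        {x \<in> topspace X. q x \<in> S} \<inter> {x \<in> topspace X. q x \<in> T}" by blast
    then show "openin X {x \<in> topspace X. q x \<in> S \<inter> T}" using S T by auto
  next
    fix K assume K: "\<forall>S\<in>K. S \<subseteq> q ` topspace X \<and> openin X {x \<in> topspace X. q x \<in> S}"
    then show "\<Union> K \<subseteq> q ` topspace X" by blast
    have "{x \<in> topspace X. q x \<in> \<Union> K} = (\<Union>S\<in>K. {x \<in> topspace X. q x \<in> S})" by blast
    then show "openin X {x \<in> topspace X. q x \<in> \<Union> K}" using K by auto
  qed
  then show ?thesis by (simp add: quotient_topology_def)
qed

lemma topspace_quotient_topology [simp]:
  "topspace (quotient_topology X q) = q ` topspace X"
proof
  show "topspace (quotient_topology X q) \<subseteq> q ` topspace X"
    using openin_quotient_topology openin_topspace by metis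
  have "{x \<in> topspace X. q x \<in> q ` topspace X} = topspace X" by blast
  then have "openin (quotient_topology X q) (q ` topspace X)"
    by (simp add: openin_quotient_topology)
  then show "q ` topspace X \<subseteq> topspace (quotient_topology X q)" by (rule openin_subset)
qed

lemma quotient_map_quotient_topology: "quotient_map X (quotient_topology X q) q"
  by (auto simp: quotient_map_def openin_quotient_topology)

definition reeb_rel :: "'a topology \<Rightarrow> ('a \<Rightarrow> 'b) \<Rightarrow> ('a \<times> 'a) set" where
  "reeb_rel X f =
     {(x, y). x \<in> topspace X \<and> y \<in> topspace X \<and> f x = f y \<and>
              connected_component_of (subtopology X {z \<in> topspace X. f z = f x}) x y}"

lemma equiv_reeb_rel: "equiv (topspace X) (reeb_rel X f)"
proof (rule equivI)
  show "reeb_rel X f \<subseteq> topspace X \<times> topspace X" by (auto simp: reeb_rel_def)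
  show "refl_on (topspace X) (reeb_rel X f)"
    by (auto simp: refl_on_def reeb_rel_def connected_component_of_refl)
  show "sym (reeb_rel X f)"
    by (auto simp: sym_def reeb_rel_def connected_component_of_sym)
  show "trans (reeb_rel X f)"
    by (auto simp: trans_def reeb_rel_def intro: connected_component_of_trans)
qed

definition reeb_quotient :: "'a topology \<Rightarrow> ('a \<Rightarrow> 'b) \<Rightarrow> 'a \<Rightarrow> 'a set" where
  "reeb_quotient X f x = reeb_rel X f `` {x}"

definition reeb_space :: "'a topology \<Rightarrow> ('a \<Rightarrow> 'b) \<Rightarrow> 'a set topology" where
  "reeb_space X f = quotient_topology X (reeb_quotient X f)"

lemma topspace_reeb_space: "topspace (reeb_space X f) = topspace X // reeb_rel X f"
  by (auto simp: reeb_space_def reeb_quotient_def quotient_def)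

definition reeb_map :: "('a \<Rightarrow> 'b) \<Rightarrow> 'a set \<Rightarrow> 'b" where
  "reeb_map f w = the_elem (f ` w)"

lemma reeb_map_reeb_quotient:
  assumes "x \<in> topspace X"
  shows "reeb_map f (reeb_quotient X f x) = f x"
proof -
  have "(x, x) \<in> reeb_rel X f"
    using equiv_reeb_rel assms by (metis equivE refl_onD)
  then have "f ` reeb_quotient X f x = {f x}"
    by (force simp: reeb_quotient_def reeb_rel_def)
  then show ?thesis by (simp add: reeb_map_def)
qed

lemma continuous_map_reeb_map:
  assumes "continuous_map X Y f"
  shows "continuous_map (reeb_space X f) Y (reeb_map f)"
proof (rule continuous_compose_quotient_map)
  show "quotient_map X (reeb_space X f) (reeb_quotient X f)"
    by (simp add: reeb_space_def quotient_map_quotient_topology)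
  show "continuous_map X Y (reeb_map f \<circ> reeb_quotient X f)"
    by (rule continuous_map_eq [OF assms]) (simp add: reeb_map_reeb_quotient)
qed

lemma reeb_map_unique:
  assumes "\<And>x. x \<in> topspace X \<Longrightarrow> g (reeb_quotient X f x) = f x"
    and "w \<in> topspace (reeb_space X f)"
  shows "g w = reeb_map f w"
  using assms by (auto simp: reeb_space_def reeb_map_reeb_quotient)

text \<open>
  A finite CW structure of dimension at most 1 on \<^term>\<open>W\<close>: \<^term>\<open>V\<close> is the set of 0-cells, and each
  \<^term>\<open>\<gamma> \<in> G\<close> is the characteristic map of a 1-cell, of which only the restriction to $[0,1]$
  matters. Loops (\<^term>\<open>\<gamma> 0 = \<gamma> 1\<close>), multi-edges and isolated vertices are allowed. The
  cells being finite in number and \<^term>\<open>W\<close> Hausdorff, \<^term>\<open>W\<close> automatically is compact and carries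
  the weak topology.
\<close>

definition graph_structure :: "'w topology \<Rightarrow> 'w set \<Rightarrow> (real \<Rightarrow> 'w) set \<Rightarrow> bool" where
  "graph_structure W V G \<longleftrightarrow>
     Hausdorff_space W \<and> finite V \<and> finite G \<and>
     (\<forall>\<gamma>\<in>G. continuous_map (top_of_set {0..1}) W \<gamma> \<and> \<gamma> 0 \<in> V \<and> \<gamma> 1 \<in> V \<and>
            embedding_map (top_of_set {0<..<1}) W \<gamma> \<and> \<gamma> ` {0<..<1} \<inter> V = {}) \<and>
     (\<forall>\<gamma>\<in>G. \<forall>\<delta>\<in>G. \<gamma> \<noteq> \<delta> \<longrightarrow> \<gamma> ` {0<..<1} \<inter> \<delta> ` {0<..<1} = {}) \<and>
     topspace W = V \<union> (\<Union>\<gamma>\<in>G. \<gamma> ` {0<..<1})"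

text \<open>An edge is taken together with its end points.\<close>

definition edges :: "(real \<Rightarrow> 'w) set \<Rightarrow> 'w set set" where
  "edges G = (\<lambda>\<gamma>. \<gamma> ` {0..1}) ` G"

end

theory Submission
  imports Defs
begin

text \<open>
  Near a point with nonvanishing differential the level sets of \<open>f\<close> are graphs over a disc, so over
  the regular values the Reeb map \<open>p\<close> is locally injective and open. Compactness then splits the part
  of the Reeb space \<open>W\<close> over a short interval around a regular value into finitely many closed sets
  (sheets) that \<open>p\<close> maps bijectively onto the interval, and sheets can be glued along regular values;
  no gradient flow is needed. Over a half-open interval of regular values ending at an arbitrary value
  \<open>c\<close>, the closure of a sheet acquires just one point over \<open>c\<close>, because fibres of \<open>p\<close> are totally
  disconnected; this gives the edges. A point of the fibre over \<open>c\<close> that is not such a limit point is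
  a connected component of \<open>W\<close>; as there are finitely many components, all fibres are finite.
\<close>

section \<open>Sheets over intervals\<close>

text \<open>Having finitely many critical values says nothing about the critical points inside one
  level: that level may be a wild compact set with, a priori, infinitely many components. So no
  local model of \<open>f\<close> at a critical level is available, and only two soft facts survive
  there: components of compact sets can be split off by clopen sets, and \<open>M\<close> has a
  finite cover by connected sets. The locale \<open>tame_map\<close> isolates what the
  one-dimensional argument needs; the smooth structure enters only through
  \<open>reeb_regular\<close> and the finite connected cover. The other obstacle is local
  injectivity of the Reeb map. A neighbourhood of a point of \<open>W\<close> comes from a
  neighbourhood of an entire class in \<open>M\<close>, whereas calculus controls \<open>f\<close>
  only near single points, so the local statement has to be propagated along the connected
  class.\<close>

definition slab :: "'w topology \<Rightarrow> ('w \<Rightarrow> real) \<Rightarrow> real set \<Rightarrow> 'w set" where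
  "slab W p I = {x \<in> topspace W. p x \<in> I}"

text \<open>For continuous \<open>p\<close> and compact \<open>W\<close> these conditions already
  make \<open>p\<close> a homeomorphism from \<open>K\<close> onto the interval
  (\<open>sheet_homeomorphic_map\<close>): a sheet is an arc parametrised by its height.\<close>

definition sheet :: "'w topology \<Rightarrow> ('w \<Rightarrow> real) \<Rightarrow> real \<Rightarrow> real \<Rightarrow> 'w set \<Rightarrow> bool" where
  "sheet W p a b K \<longleftrightarrow> closedin W K \<and> inj_on p K \<and> p ` K = {a..b}"

lemma slab_iff: "x \<in> slab W p I \<longleftrightarrow> x \<in> topspace W \<and> p x \<in> I"
  by (simp add: slab_def)

lemma openin_slab: "continuous_map W euclideanreal p \<Longrightarrow> open I \<Longrightarrow> openin W (slab W p I)"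
  unfolding slab_def by (rule openin_continuous_map_preimage) auto

lemma closedin_slab: "continuous_map W euclideanreal p \<Longrightarrow> closed I \<Longrightarrow> closedin W (slab W p I)"
  unfolding slab_def by (rule closedin_continuous_map_preimage) auto

lemma closed_map_real:
  assumes "compact_space W" "continuous_map W euclideanreal p"
  shows "closed_map W euclideanreal p"
  by (rule continuous_imp_closed_map_gen) (use assms in \<open>auto intro: Hausdorff_imp_kc_space\<close>)

text \<open>Tube lemma: \<open>p\<close> is closed, so the image of the complement of
  \<open>U\<close> is a closed set missing \<open>t\<close>, hence missing an interval about
  \<open>t\<close>.\<close>

lemma slab_tube:
  assumes "compact_space W" "continuous_map W euclideanreal p" "openin W U" "slab W p {t} \<subseteq> U"
  obtains d where "d > 0" "slab W p {t-d<..<t+d} \<subseteq> U"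
proof -
  have "closed (p ` (topspace W - U))"
    using closed_map_real[OF assms(1,2)] assms(3) by (auto simp: closed_map_def)
  moreover have "t \<in> - p ` (topspace W - U)" using assms(4) by (auto simp: slab_def)
  ultimately obtain d where d: "d > 0" "ball t d \<subseteq> - p ` (topspace W - U)"
    by (metis open_Compl open_contains_ball)
  show thesis
  proof (rule that[OF d(1)], rule subsetI)
    fix x assume "x \<in> slab W p {t-d<..<t+d}"
    then have "x \<in> topspace W" "p x \<in> ball t d" by (auto simp: slab_def dist_real_def)
    then show "x \<in> U" using d(2) by blast
  qed
qed

lemma sheet_homeomorphic_map:
  assumes "compact_space W" "continuous_map W euclideanreal p" "sheet W p a b K"
  shows "homeomorphic_map (subtopology W K) (top_of_set {a..b}) p"
proof -
  have K: "closedin W K" "inj_on p K" "p ` K = {a..b}" using assms by (auto simp: sheet_def)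
  then have KW: "K \<subseteq> topspace W" by (simp add: closedin_subset)
  have c: "continuous_map (subtopology W K) (top_of_set {a..b}) p"
    using assms(2) K(3) by (auto simp: continuous_map_in_subtopology continuous_map_from_subtopology)
  show ?thesis
  proof (rule bijective_closed_imp_homeomorphic_map[OF c])
    show "closed_map (subtopology W K) (top_of_set {a..b}) p"
      by (rule continuous_imp_closed_map_gen[OF _ _ c])
        (use assms(1) K(1) in \<open>auto intro!: Hausdorff_imp_kc_space simp: Hausdorff_space_subtopology closedin_compact_space compact_space_subtopology\<close>)
  qed (use K KW in \<open>auto simp: Int_absorb1\<close>)
qed

lemma sheet_connectedin:
  assumes "compact_space W" "continuous_map W euclideanreal p" "sheet W p a b K"
  shows "connectedin W K"
proof -
  have "homeomorphic_map (subtopology W K) (top_of_set {a..b}) p"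
    by (rule sheet_homeomorphic_map[OF assms])
  moreover have "connected_space (top_of_set {a..b})" 
    using connected_Icc[of a b] by (simp add: connectedin_def flip: connectedin_iff_connected)
  ultimately have "connected_space (subtopology W K)"
    using homeomorphic_connected_space homeomorphic_map_imp_homeomorphic_space by blast
  moreover have "K \<subseteq> topspace W" using assms(3) by (auto simp: sheet_def closedin_subset)
  ultimately show ?thesis by (simp add: connectedin_def)
qed

lemma sheet_restrict:
  assumes "continuous_map W euclideanreal p" "sheet W p a b K" "a \<le> a'" "b' \<le> b"
  shows "sheet W p a' b' (K \<inter> slab W p {a'..b'})"
  unfolding sheet_def
proof (intro conjI)
  have K: "closedin W K" "inj_on p K" "p ` K = {a..b}" "K \<subseteq> topspace W"
    using assms by (auto simp: sheet_def closedin_subset)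
  show "closedin W (K \<inter> slab W p {a'..b'})" by (simp add: K(1) closedin_Int closedin_slab assms(1))
  show "inj_on p (K \<inter> slab W p {a'..b'})" using K(2) inj_on_subset by blast
  have "{a'..b'} \<subseteq> p ` K" using K(3) assms by auto
  then have "\<exists>z\<in>K. p z = x" if "x \<in> {a'..b'}" for x using that by blast
  then show "p ` (K \<inter> slab W p {a'..b'}) = {a'..b'}"
    using K(4) by (fastforce simp: slab_def image_iff)
qed

text \<open>Reversing heights carries results on intervals open at the left end over to intervals
  open at the right end.\<close>

lemma sheet_uminus: "sheet W (\<lambda>x. - p x) (-b) (-a) K \<longleftrightarrow> sheet W p a b K"
proof -
  have "(\<lambda>x. - p x) ` K = uminus ` (p ` K)" by (simp add: image_image)
  moreover have "uminus ` (p ` K) = {-b..-a} \<longleftrightarrow> p ` K = {a..b}"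
  proof
    assume "uminus ` (p ` K) = {-b..-a}"
    then have "uminus ` uminus ` p ` K = uminus ` {-b..-a}" by (rule arg_cong)
    then show "p ` K = {a..b}" by (simp add: image_image)
  qed simp
  ultimately show ?thesis by (auto simp: sheet_def inj_on_def)
qed

text \<open>The empty family is allowed, for intervals that \<open>p\<close> does not reach.\<close>

definition sheeted :: "'w topology \<Rightarrow> ('w \<Rightarrow> real) \<Rightarrow> real \<Rightarrow> real \<Rightarrow> bool" where
  "sheeted W p a b \<longleftrightarrow> (\<exists>\<K>. finite \<K> \<and> (\<forall>K\<in>\<K>. sheet W p a b K) \<and> disjoint \<K> \<and> \<Union>\<K> = slab W p {a..b})"

text \<open>Every sheet on either side has exactly one point at level \<open>b\<close>, and every
  point at that level lies in exactly one sheet of each family. Meeting at level \<open>b\<close>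
  therefore matches the two families bijectively, and matched pairs are glued.\<close>

lemma sheeted_trans:
  assumes "sheeted W p a b" "sheeted W p b c" "a \<le> b" "b \<le> c"
  shows "sheeted W p a c"
proof -
  obtain \<K> where K: "finite \<K>" "\<And>K. K\<in>\<K> \<Longrightarrow> sheet W p a b K" "disjoint \<K>" "\<Union>\<K> = slab W p {a..b}"
    using assms by (auto simp: sheeted_def)
  obtain \<L> where L: "finite \<L>" "\<And>K. K\<in>\<L> \<Longrightarrow> sheet W p b c K" "disjoint \<L>" "\<Union>\<L> = slab W p {b..c}"
    using assms by (auto simp: sheeted_def)
  define M where "M = (\<lambda>(K,L). K \<union> L) ` {(K,L) \<in> \<K> \<times> \<L>. K \<inter> L \<noteq> {}}"
  have K2: "closedin W k" "inj_on p k" "p ` k = {a..b}" if "k \<in> \<K>" for k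
    using K(2)[OF that] by (auto simp: sheet_def)
  have L2: "closedin W k" "inj_on p k" "p ` k = {b..c}" if "k \<in> \<L>" for k
    using L(2)[OF that] by (auto simp: sheet_def)
  have Ku: "k = k'" if "k\<in>\<K>" "k'\<in>\<K>" "x \<in> k" "x \<in> k'" for k k' x
    using K(3) that by (auto simp: disjoint_def)
  have Lu: "k = k'" if "k\<in>\<L>" "k'\<in>\<L>" "x \<in> k" "x \<in> k'" for k k' x
    using L(3) that by (auto simp: disjoint_def)
  have Kp: "a \<le> p x \<and> p x \<le> b" if "k \<in> \<K>" "x \<in> k" for k x using K2(3)[OF that(1)] that by auto
  have Lp: "b \<le> p x \<and> p x \<le> c" if "k \<in> \<L>" "x \<in> k" for k x using L2(3)[OF that(1)] that by auto
  \<comment> \<open>A common point of \<open>k\<close> and \<open>l\<close> must have height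
    \<open>b\<close>; injectivity on each sheet makes it the only point of
    \<open>k \<union> l\<close> at that height.\<close>
  have meet: "x \<in> k \<inter> l" if "k \<in> \<K>" "l \<in> \<L>" and ne: "k \<inter> l \<noteq> {}" and "x \<in> k \<union> l" "p x = b" for k l x
  proof -
    obtain z where z: "z \<in> k" "z \<in> l" using ne by auto
    then have pz: "p z = b" using Kp[OF that(1)] Lp[OF that(2)] by (metis order_antisym)
    show ?thesis
      using that K2(2)[OF that(1)] L2(2)[OF that(2)] z pz by (metis Int_iff Un_iff inj_onD)
  qed
  have Kb: "\<exists>x\<in>k. p x = b" if "k \<in> \<K>" for k
    using K2(3)[OF that] assms(3) by (metis atLeastAtMost_iff imageE order_refl)
  have Lb: "\<exists>x\<in>k. p x = b" if "k \<in> \<L>" for k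
    using L2(3)[OF that] assms(4) by (metis atLeastAtMost_iff imageE order_refl)
  have fin: "finite M" unfolding M_def
    by (rule finite_imageI) (rule finite_subset[of _ "\<K> \<times> \<L>"], use K L in auto)
  have sh: "sheet W p a c N" if NM: "N \<in> M" for N
  proof -
    obtain k l where kl: "k \<in> \<K>" "l \<in> \<L>" "k \<inter> l \<noteq> {}" "N = k \<union> l" using NM by (auto simp: M_def)
    have "inj_on p (k \<union> l)"
    proof (rule inj_onI)
      fix x y assume xy: "x \<in> k \<union> l" "y \<in> k \<union> l" "p x = p y"
      show "x = y"
      proof (cases "p x = b")
        case True
        then have "x \<in> k" "y \<in> k" using meet[OF kl(1-3)] xy by auto
        then show ?thesis using K2(2)[OF kl(1)] xy by (auto dest: inj_onD)
      next
        case False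
        then have "x \<in> k \<and> y \<in> k \<or> x \<in> l \<and> y \<in> l"
          using xy Kp[OF kl(1)] Lp[OF kl(2)] by (metis Un_iff order_antisym)
        then show ?thesis using K2(2)[OF kl(1)] L2(2)[OF kl(2)] xy by (auto dest: inj_onD)
      qed
    qed
    moreover have "p ` (k \<union> l) = {a..c}"
      using K2(3)[OF kl(1)] L2(3)[OF kl(2)] assms by (auto simp: image_Un)
    ultimately show ?thesis using K2(1)[OF kl(1)] L2(1)[OF kl(2)] kl by (auto simp: sheet_def)
  qed
  have un: "\<Union>M = slab W p {a..c}"
  proof (intro equalityI subsetI)
    fix x assume "x \<in> \<Union>M"
    then obtain k l where kl: "k \<in> \<K>" "l \<in> \<L>" "x \<in> k \<union> l" by (auto simp: M_def)
    have "k \<subseteq> topspace W" "l \<subseteq> topspace W" using K2(1)[OF kl(1)] L2(1)[OF kl(2)] closedin_subset by auto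
    then show "x \<in> slab W p {a..c}" using kl Kp[OF kl(1)] Lp[OF kl(2)] assms by (fastforce simp: slab_def)
  next
    fix x assume x: "x \<in> slab W p {a..c}"
    show "x \<in> \<Union>M"
    proof (cases "p x \<le> b")
      case True
      then have "x \<in> \<Union>\<K>" using x K(4) by (auto simp: slab_def)
      then obtain k where k: "k \<in> \<K>" "x \<in> k" by auto
      obtain z where z: "z \<in> k" "p z = b" using Kb[OF k(1)] by auto
      then have "z \<in> \<Union>\<L>" using L(4) k K2(1)[OF k(1)] assms closedin_subset by (fastforce simp: slab_def)
      then obtain l where "l \<in> \<L>" "z \<in> l" by auto
      then show ?thesis using k z by (fastforce simp: M_def)
    next
      case False
      then have "x \<in> \<Union>\<L>" using x L(4) by (auto simp: slab_def)
      then obtain k where k: "k \<in> \<L>" "x \<in> k" by auto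
      obtain z where z: "z \<in> k" "p z = b" using Lb[OF k(1)] by auto
      then have "z \<in> \<Union>\<K>" using K(4) k L2(1)[OF k(1)] assms closedin_subset by (fastforce simp: slab_def)
      then obtain l where "l \<in> \<K>" "z \<in> l" by auto
      then show ?thesis using k z by (fastforce simp: M_def)
    qed
  qed
  have "N = N'" if NM: "N \<in> M" "N' \<in> M" "x \<in> N" "x \<in> N'" for N N' x
  proof -
    obtain k l where kl: "k \<in> \<K>" "l \<in> \<L>" "k \<inter> l \<noteq> {}" "N = k \<union> l" using NM by (auto simp: M_def)
    obtain k' l' where kl': "k' \<in> \<K>" "l' \<in> \<L>" "k' \<inter> l' \<noteq> {}" "N' = k' \<union> l'" using NM by (auto simp: M_def)
    have xx: "x \<in> k \<and> x \<in> k' \<or> x \<in> l \<and> x \<in> l'"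
    proof (cases "p x = b")
      case True
      then show ?thesis using meet[OF kl(1-3)] meet[OF kl'(1-3)] that kl kl' by auto
    next
      case False
      then show ?thesis
        using that kl kl' Kp[OF kl(1)] Lp[OF kl(2)] Kp[OF kl'(1)] Lp[OF kl'(2)] by (metis Un_iff order_antisym)
    qed
    \<comment> \<open>Either half of a glued pair determines the other through its point at level
      \<open>b\<close>.\<close>
    have "k = k' \<longleftrightarrow> l = l'"
    proof
      assume e: "k = k'"
      obtain z where "z \<in> k" "p z = b" using Kb kl by auto
      then have "z \<in> l" "z \<in> l'" using meet[OF kl(1-3)] meet[OF kl'(1-3)] e by auto
      then show "l = l'" using Lu kl kl' by blast
    next
      assume e: "l = l'"
      obtain z where "z \<in> l" "p z = b" using Lb kl by auto
      then have "z \<in> k" "z \<in> k'" using meet[OF kl(1-3)] meet[OF kl'(1-3)] e by auto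
      then show "k = k'" using Ku kl kl' by blast
    qed
    then show ?thesis using xx Ku Lu kl kl' by metis
  qed
  then have "disjoint M" by (auto simp: disjoint_def)
  then show ?thesis using fin sh un by (auto simp: sheeted_def)
qed

section \<open>Light maps that are local homeomorphisms off finitely many levels\<close>

lemma Hausdorff_if_light:
  assumes continuous: "continuous_map W euclideanreal p"
    and light: "\<And>w z. \<lbrakk>w \<in> topspace W; z \<in> topspace W; w \<noteq> z; p w = p z\<rbrakk> \<Longrightarrow>
      \<exists>A B. openin W A \<and> openin W B \<and> w \<in> A \<and> z \<in> B \<and> A \<inter> B = {}"
  shows "Hausdorff_space W"
  unfolding Hausdorff_space_def
proof (intro allI impI)
  fix x y assume xy: "x \<in> topspace W \<and> y \<in> topspace W \<and> x \<noteq> y"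
  show "\<exists>U V. openin W U \<and> openin W V \<and> x \<in> U \<and> y \<in> V \<and> disjnt U V"
  proof (cases "p x = p y")
    case True
    then show ?thesis using light[of x y] xy by (auto simp: disjnt_def)
  next
    case False
    then obtain U V where "open U" "open V" "p x \<in> U" "p y \<in> V" "U \<inter> V = {}" by (meson hausdorff)
    then have "openin W (slab W p U) \<and> openin W (slab W p V) \<and> x \<in> slab W p U \<and> y \<in> slab W p V \<and>
        disjnt (slab W p U) (slab W p V)"
      using xy by (intro conjI openin_slab continuous) (auto simp: disjnt_def slab_def)
    then show ?thesis by blast
  qed
qed

text \<open>\<open>light\<close> is stronger than Hausdorffness: the separating sets cover the
  fibre, so a connected subset of a fibre has at most one point, and by \<open>slab_tube\<close> the
  splitting persists on nearby levels. \<open>S\<close> will be the set of critical values.\<close>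

locale tame_map =
  fixes W :: "'w topology" and p :: "'w \<Rightarrow> real" and S :: "real set"
  assumes compact: "compact_space W"
    and continuous: "continuous_map W euclideanreal p"
    and light: "\<lbrakk>w \<in> topspace W; z \<in> topspace W; w \<noteq> z; p w = p z\<rbrakk> \<Longrightarrow>
      \<exists>A B. openin W A \<and> openin W B \<and> w \<in> A \<and> z \<in> B \<and> A \<inter> B = {} \<and> slab W p {p w} \<subseteq> A \<union> B"
    and finite_exceptional: "finite S"
    and locally_inj: "\<lbrakk>w \<in> topspace W; p w \<notin> S\<rbrakk> \<Longrightarrow> \<exists>N. openin W N \<and> w \<in> N \<and> inj_on p N"
    and locally_open: "\<lbrakk>openin W N; w \<in> N; p w \<notin> S\<rbrakk> \<Longrightarrow> \<exists>d>0. {p w - d<..<p w + d} \<subseteq> p ` N"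
    and finite_connected_cover: "\<exists>\<Y>. finite \<Y> \<and> (\<forall>Y\<in>\<Y>. connectedin W Y) \<and> topspace W \<subseteq> \<Union>\<Y>"

lemma tame_map_uminus:
  assumes "tame_map W p S"
  shows "tame_map W (\<lambda>x. - p x) (uminus ` S)"
proof -
  interpret tame_map W p S by fact
  have slab: "slab W (\<lambda>x. - p x) {- t} = slab W p {t}" for t by (auto simp: slab_def)
  have notin: "t \<notin> S" if "- t \<notin> uminus ` S" for t using that by blast
  show ?thesis
  proof
    fix N w assume N: "openin W N" "w \<in> N" "- p w \<notin> uminus ` S"
    obtain d where d: "d > 0" "{p w - d<..<p w + d} \<subseteq> p ` N" using locally_open[OF N(1,2) notin[OF N(3)]] by blast
    have "s \<in> (\<lambda>x. - p x) ` N" if "s \<in> {- p w - d<..<- p w + d}" for s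
    proof -
      have "- s \<in> {p w - d<..<p w + d}" using that by auto
      then have "- s \<in> p ` N" using d(2) by blast
      then obtain x where "x \<in> N" "- s = p x" by (rule imageE) auto
      then show ?thesis by (intro image_eqI[of _ _ x]) auto
    qed
    then show "\<exists>d>0. {- p w - d<..<- p w + d} \<subseteq> (\<lambda>x. - p x) ` N" using d(1) by blast
  next
    fix w assume "w \<in> topspace W" "- p w \<notin> uminus ` S"
    then show "\<exists>N. openin W N \<and> w \<in> N \<and> inj_on (\<lambda>x. - p x) N"
      using locally_inj[OF _ notin, of w] by (simp add: inj_on_def)
  next
    fix w z assume "w \<in> topspace W" "z \<in> topspace W" "w \<noteq> z" "- p w = - p z"
    then show "\<exists>A B. openin W A \<and> openin W B \<and> w \<in> A \<and> z \<in> B \<and> A \<inter> B = {} \<and>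
        slab W (\<lambda>x. - p x) {- p w} \<subseteq> A \<union> B"
      unfolding slab using light[of w z] by simp
  qed (use compact continuous finite_exceptional finite_connected_cover in \<open>auto intro: continuous_intros\<close>)
qed

context tame_map
begin

section \<open>Regular fibres and sheets over regular intervals\<close>

lemma Hausdorff: "Hausdorff_space W"
proof (rule Hausdorff_if_light[OF continuous])
  fix w z assume "w \<in> topspace W" "z \<in> topspace W" "w \<noteq> z" "p w = p z"
  from light[OF this]
  show "\<exists>A B. openin W A \<and> openin W B \<and> w \<in> A \<and> z \<in> B \<and> A \<inter> B = {}" by (elim exE conjE) (intro exI conjI)
qed

text \<open>The fibre is compact, and an injectivity neighbourhood of one of its points contains no
  other.\<close>

lemma finite_regular_fibre:
  assumes "t \<notin> S"
  shows "finite (slab W p {t})"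
proof -
  have "\<exists>N. openin W N \<and> w \<in> N \<and> inj_on p N" if "w \<in> slab W p {t}" for w
    using locally_inj that assms by (auto simp: slab_def)
  then obtain N where N: "\<And>w. w \<in> slab W p {t} \<Longrightarrow> openin W (N w) \<and> w \<in> N w \<and> inj_on p (N w)"
    by metis
  have "compactin W (slab W p {t})"
    by (simp add: closedin_compact_space compact closedin_slab continuous)
  then obtain \<F> where F: "finite \<F>" "\<F> \<subseteq> N ` slab W p {t}" "slab W p {t} \<subseteq> \<Union>\<F>"
    using N compactinD[of W "slab W p {t}" "N ` slab W p {t}"] by blast
  obtain T where T: "T \<subseteq> slab W p {t}" "finite T" "\<F> = N ` T" using F by (metis finite_subset_image)
  have "slab W p {t} \<subseteq> T"
  proof
    fix x assume x: "x \<in> slab W p {t}"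
    then obtain w where w: "w \<in> T" "x \<in> N w" using F T by auto
    have "w \<in> slab W p {t}" using w T by auto
    then have "x = w" using x w N[of w] by (auto simp: slab_def dest: inj_onD)
    then show "x \<in> T" using w by simp
  qed
  then show ?thesis using T finite_subset by auto
qed

lemma disjoint_nhds:
  assumes "finite F" "F \<subseteq> topspace W"
  obtains N where "\<And>w. w \<in> F \<Longrightarrow> openin W (N w) \<and> w \<in> N w"
    "\<And>w z. w \<in> F \<Longrightarrow> z \<in> F \<Longrightarrow> w \<noteq> z \<Longrightarrow> N w \<inter> N z = {}"
proof -
  have "\<exists>U V. openin W U \<and> openin W V \<and> w \<in> U \<and> z \<in> V \<and> disjnt U V" if "w \<in> F" "z \<in> F" "w \<noteq> z" for w z
    using Hausdorff that assms unfolding Hausdorff_space_def by blast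
  then obtain U V where UV: "\<And>w z. w \<in> F \<Longrightarrow> z \<in> F \<Longrightarrow> w \<noteq> z \<Longrightarrow>
      openin W (U w z) \<and> openin W (V w z) \<and> w \<in> U w z \<and> z \<in> V w z \<and> disjnt (U w z) (V w z)"
    by metis
  \<comment> \<open>The separating pairs for \<open>(w, z)\<close> and \<open>(z, w)\<close> are
    chosen independently, so both cuts are needed: \<open>N w\<close> lies in \<open>U w z\<close>
    and \<open>N z\<close> in \<open>V w z\<close>.\<close>
  define N where "N w = topspace W \<inter> (\<Inter>z\<in>F-{w}. U w z \<inter> V z w)" for w
  show thesis
  proof (rule that[of N])
    fix w assume w: "w \<in> F"
    have "openin W (N w)"
    proof (cases "F - {w} = {}")
      case False
      then have "openin W (\<Inter>z\<in>F-{w}. U w z \<inter> V z w)"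
        using UV w assms by (intro openin_INT2) auto
      then show ?thesis by (auto simp: N_def)
    next
      case True
      show ?thesis unfolding N_def True by simp
    qed
    then show "openin W (N w) \<and> w \<in> N w" using UV w assms by (auto simp: N_def)
  next
    fix w z assume "w \<in> F" "z \<in> F" "w \<noteq> z"
    then show "N w \<inter> N z = {}" using UV[of w z] by (fastforce simp: N_def disjnt_def)
  qed
qed

text \<open>Disjoint injectivity neighbourhoods of the finitely many points over \<open>t\<close>
  contain everything over a short interval, by the tube lemma, and each reaches every level of it,
  by openness. Allowing all short \<open>a \<le> t \<le> b\<close> is the form that
  \<open>Bolzano\<close> asks for.\<close>

lemma locally_sheeted:
  assumes t: "t \<notin> S"
  shows "\<exists>d>0. \<forall>a b. a \<le> t \<and> t \<le> b \<and> b - a < d \<longrightarrow> sheeted W p a b"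
proof -
  define F where "F = slab W p {t}"
  have F: "finite F" "F \<subseteq> topspace W" using finite_regular_fibre[OF t] by (auto simp: F_def slab_def)
  have Fp: "p w = t" if "w \<in> F" for w using that by (auto simp: F_def slab_def)
  obtain N1 where N1: "\<And>w. w \<in> F \<Longrightarrow> openin W (N1 w) \<and> w \<in> N1 w"
    "\<And>w z. w \<in> F \<Longrightarrow> z \<in> F \<Longrightarrow> w \<noteq> z \<Longrightarrow> N1 w \<inter> N1 z = {}"
    using disjoint_nhds[OF F] by metis
  have "\<exists>N. openin W N \<and> w \<in> N \<and> inj_on p N" if "w \<in> F" for w
    using locally_inj that t F Fp by (metis subsetD)
  then obtain N2 where N2: "\<And>w. w \<in> F \<Longrightarrow> openin W (N2 w) \<and> w \<in> N2 w \<and> inj_on p (N2 w)" by metis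
  define N where "N w = N1 w \<inter> N2 w" for w
  have N: "openin W (N w)" "w \<in> N w" "inj_on p (N w)" if "w \<in> F" for w
    using N1(1)[OF that] N2[OF that] by (auto simp: N_def inj_on_subset)
  have Nd: "N w \<inter> N z = {}" if "w \<in> F" "z \<in> F" "w \<noteq> z" for w z
    using N1(2)[OF that] by (auto simp: N_def)
  have Nt: "N w \<subseteq> topspace W" if "w \<in> F" for w using N(1)[OF that] openin_subset by auto
  have "\<exists>d>0. {t - d<..<t + d} \<subseteq> p ` N w" if "w \<in> F" for w
    using locally_open[OF N(1,2)[OF that]] Fp[OF that] t by simp
  then obtain d where d: "\<And>w. w \<in> F \<Longrightarrow> d w > 0 \<and> {t - d w<..<t + d w} \<subseteq> p ` N w" by metis
  have "openin W (\<Union>w\<in>F. N w)" using N by blast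
  moreover have "slab W p {t} \<subseteq> (\<Union>w\<in>F. N w)" using N(2) by (auto simp: F_def)
  ultimately obtain e where e: "e > 0" "slab W p {t-e<..<t+e} \<subseteq> (\<Union>w\<in>F. N w)"
    by (rule slab_tube[OF compact continuous])
  \<comment> \<open>The bound \<open>e\<close> keeps the slab inside the union of the
    neighbourhoods; the bounds \<open>d w\<close> let each neighbourhood cover the interval.\<close>
  define m where "m = Min (insert e (d ` F))"
  have m: "m > 0" "m \<le> e" "\<And>w. w \<in> F \<Longrightarrow> m \<le> d w" using F d e by (auto simp: m_def)
  show ?thesis
  proof (intro exI[of _ m] conjI allI impI m(1))
    fix a b assume ab: "a \<le> t \<and> t \<le> b \<and> b - a < m"
    define K where "K w = N w \<inter> slab W p {a..b}" for w
    have sub: "slab W p {a..b} \<subseteq> (\<Union>w\<in>F. N w)"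
      using e(2) ab m(2) by (force simp: slab_def)
    have "sheet W p a b (K w)" if w: "w \<in> F" for w
      unfolding sheet_def
    proof (intro conjI)
      \<comment> \<open>By disjointness, removing the other open neighbourhoods from the closed slab
        leaves exactly \<open>K w\<close>.\<close>
      have "K w = slab W p {a..b} - (\<Union>z\<in>F-{w}. N z)" using sub Nd w by (auto simp: K_def)
      moreover have "openin W (\<Union>z\<in>F-{w}. N z)" using N by blast
      ultimately show "closedin W (K w)" by (simp add: closedin_diff closedin_slab continuous)
      show "inj_on p (K w)" using N(3)[OF w] by (auto simp: K_def inj_on_def)
      have "{a..b} \<subseteq> p ` N w" using d[OF w] ab m(3)[OF w] by force
      then have "\<exists>z\<in>N w. p z = x" if "x \<in> {a..b}" for x using that by blast
      then show "p ` K w = {a..b}" using Nt[OF w] by (fastforce simp: K_def slab_def image_iff)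
    qed
    moreover have "disjoint (K ` F)" using Nd by (fastforce simp: disjoint_def K_def)
    moreover have "\<Union>(K ` F) = slab W p {a..b}" using sub by (auto simp: K_def)
    ultimately show "sheeted W p a b" unfolding sheeted_def using F(1) by (intro exI[of _ "K ` F"]) auto
  qed
qed

lemma sheeted_if_regular:
  assumes "a \<le> b" "{a..b} \<inter> S = {}"
  shows "sheeted W p a b"
proof -
  \<comment> \<open>The condition on \<open>S\<close> is made part of the inductive predicate: every
    interval around a point of \<open>S\<close> violates it, so the local step is vacuous
    there.\<close>
  have "{a..b} \<inter> S = {} \<longrightarrow> sheeted W p a b"
    using assms(1)
  proof (induction rule: Bolzano)
    case (trans a b c)
    show ?case
    proof
      assume "{a..c} \<inter> S = {}"
      moreover have "{a..b} \<subseteq> {a..c}" "{b..c} \<subseteq> {a..c}" using trans by auto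
      ultimately have "{a..b} \<inter> S = {}" "{b..c} \<inter> S = {}" by blast+
      then show "sheeted W p a c" using trans sheeted_trans by metis
    qed
  next
    case (local t)
    show ?case
    proof (cases "t \<in> S")
      case True
      then show ?thesis by (intro exI[of _ 1]) auto
    next
      case False
      then show ?thesis using locally_sheeted by meson
    qed
  qed
  then show ?thesis using assms by simp
qed

text \<open>In the union of a finite disjoint family of closed sets every member is clopen.\<close>

lemma connected_in_one_sheet:
  assumes "finite \<K>" "\<And>K. K \<in> \<K> \<Longrightarrow> closedin W K" "disjoint \<K>" "connectedin W C" "C \<subseteq> \<Union>\<K>"
    "K \<in> \<K>" "x \<in> C" "x \<in> K"
  shows "C \<subseteq> K"
proof -
  have "connectedin (subtopology W (\<Union>\<K>)) C" using assms by (simp add: connectedin_subtopology)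
  moreover have cl: "closedin (subtopology W (\<Union>\<K>)) L" if "L \<in> \<K>" for L
    using assms(2)[OF that] that by (intro closedin_subset_topspace) auto
  moreover have "openin (subtopology W (\<Union>\<K>)) K"
  proof -
    have top: "topspace (subtopology W (\<Union>\<K>)) = \<Union>\<K>"
      using assms(2) closedin_subset by (auto simp: topspace_subtopology)
    have "closedin (subtopology W (\<Union>\<K>)) (\<Union>(\<K> - {K}))" using cl assms(1) by (intro closedin_Union) auto
    moreover have "\<Union>\<K> - \<Union>(\<K> - {K}) = K" using assms(3,6) by (fastforce simp: disjoint_def)
    ultimately show ?thesis using top by (metis openin_diff openin_topspace)
  qed
  ultimately have "C \<subseteq> K \<or> disjnt C K" using cl[OF assms(6)] connectedin_clopen_cases by metis
  then show ?thesis using assms(7,8) by (auto simp: disjnt_def)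
qed

text \<open>Each edge ending over \<open>c\<close> is the closure of an increasing union of sheets over \<open>[s, y]\<close>
  with \<open>s\<close> decreasing to \<open>c\<close>; two limit points over \<open>c\<close> would disconnect a sheet by lightness.\<close>

lemma one_sided_sheets:
  assumes cy: "c < y" and reg: "{c<..y} \<inter> S = {}"
  shows "\<exists>\<K>. finite \<K> \<and> (\<forall>K\<in>\<K>. sheet W p c y K) \<and>
    (\<forall>K\<in>\<K>. \<forall>L\<in>\<K>. K \<noteq> L \<longrightarrow> K \<inter> L \<subseteq> slab W p {c}) \<and> slab W p {c<..y} \<subseteq> \<Union>\<K>"
proof -
  have "sheeted W p s y" if "s \<in> {c<..y}" for s
    
  proof (rule sheeted_if_regular)
    have "{s..y} \<subseteq> {c<..y}" using that by auto
    then show "{s..y} \<inter> S = {}" using reg by blast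
  qed (use that in auto)
  then obtain \<V> where V0: "\<And>s. s \<in> {c<..y} \<Longrightarrow> finite (\<V> s) \<and> (\<forall>K\<in>\<V> s. sheet W p s y K) \<and>
      disjoint (\<V> s) \<and> \<Union>(\<V> s) = slab W p {s..y}"
    unfolding sheeted_def by metis
  \<comment> \<open>Each sheet over \<open>{s..y}\<close> has exactly one point over
    \<open>y\<close>, so the finite fibre over \<open>y\<close> labels the sheets consistently for
    all \<open>s\<close>.\<close>
  define F where "F = slab W p {y}"
  have F: "finite F" unfolding F_def by (rule finite_regular_fibre) (use cy reg in auto)
  have Fp: "w \<in> topspace W" "p w = y" if "w \<in> F" for w using that by (auto simp: F_def slab_def)
  have "\<exists>K\<in>\<V> s. w \<in> K" if "s \<in> {c<..y}" "w \<in> F" for s w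
  proof -
    have "w \<in> \<Union>(\<V> s)" using V0[OF that(1)] Fp[OF that(2)] that by (auto simp: slab_def)
    then show ?thesis by blast
  qed
  then obtain V where VM: "\<And>s w. s \<in> {c<..y} \<Longrightarrow> w \<in> F \<Longrightarrow> V s w \<in> \<V> s \<and> w \<in> V s w" by metis
  have uniq: "K = L" if "s \<in> {c<..y}" "K \<in> \<V> s" "L \<in> \<V> s" "x \<in> K" "x \<in> L" for s K L x
    using V0[OF that(1)] that by (auto simp: disjoint_def)
  have Vs: "sheet W p s y (V s w)" if "s \<in> {c<..y}" "w \<in> F" for s w
    using V0[OF that(1)] VM[OF that] by blast
  have Vc: "closedin W (V s w)" "inj_on p (V s w)" "p ` V s w = {s..y}" if "s \<in> {c<..y}" "w \<in> F" for s w
    using Vs[OF that] by (auto simp: sheet_def)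
  have Vslab: "V s w \<subseteq> slab W p {s..y}" if "s \<in> {c<..y}" "w \<in> F" for s w
    using V0[OF that(1)] VM[OF that] by blast
  \<comment> \<open>Being connected, \<open>V s w\<close> stays in the sheet through
    \<open>w\<close> over the longer interval; injectivity of \<open>p\<close> there leaves no
    further points over \<open>{s..y}\<close>.\<close>
  have mono: "V s w = V s' w \<inter> slab W p {s..y}" if s: "s \<in> {c<..y}" "s' \<in> {c<..y}" "s' \<le> s" "w \<in> F" for s s' w
  proof -
    have sub: "V s w \<subseteq> V s' w"
    proof (rule connected_in_one_sheet)
      show "finite (\<V> s')" "disjoint (\<V> s')" using V0[OF s(2)] by auto
      show "closedin W K" if "K \<in> \<V> s'" for K using V0[OF s(2)] that by (auto simp: sheet_def)
      show "connectedin W (V s w)" by (rule sheet_connectedin[OF compact continuous Vs[OF s(1,4)]])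
      show "V s w \<subseteq> \<Union>(\<V> s')" using V0[OF s(2)] Vslab[OF s(1,4)] s(3) by (auto simp: slab_def)
      show "V s' w \<in> \<V> s'" "w \<in> V s w" "w \<in> V s' w" using VM s by auto
    qed
    have "x \<in> V s w" if x: "x \<in> V s' w" "x \<in> slab W p {s..y}" for x
    proof -
      have "p x \<in> p ` V s w" using x(2) Vc(3)[OF s(1,4)] by (auto simp: slab_def)
      then obtain z where z: "z \<in> V s w" "p z = p x" by force
      then have "z = x" using sub x(1) Vc(2)[OF s(2,4)] by (auto dest: inj_onD)
      then show ?thesis using z by simp
    qed
    then show ?thesis using sub Vslab[OF s(1,4)] by blast
  qed
  define E where "E w = (\<Union>s\<in>{c<..y}. V s w)" for w
  \<comment> \<open>From level \<open>s\<close> upwards the increasing union no longer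
    grows.\<close>
  have Eslab: "E w \<inter> slab W p {s..y} = V s w" if s: "s \<in> {c<..y}" "w \<in> F" for s w
  proof -
    have "x \<in> V s w" if x: "s' \<in> {c<..y}" "x \<in> V s' w" "x \<in> slab W p {s..y}" for x s'
      using mono[OF s(1) x(1) _ s(2)] mono[OF x(1) s(1) _ s(2)] x by (cases "s' \<le> s") auto
    then show ?thesis using s Vslab[OF s] by (auto simp: E_def)
  qed
  have Esub: "E w \<subseteq> slab W p {c<..y}" if "w \<in> F" for w
    using Vslab[OF _ that] by (fastforce simp: E_def slab_def)
  have Eim: "{c<..y} \<subseteq> p ` E w" if "w \<in> F" for w
  proof
    fix s assume s: "s \<in> {c<..y}"
    then have "s \<in> p ` V s w" using Vc(3)[OF s that] by auto
    moreover have "V s w \<subseteq> E w" using s by (auto simp: E_def)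
    ultimately show "s \<in> p ` E w" by blast
  qed
  define K where "K w = W closure_of (E w)" for w
  have EK: "E w \<subseteq> K w" if "w \<in> F" for w
    unfolding K_def by (rule closure_of_subset) (use Esub[OF that] in \<open>auto simp: slab_def\<close>)
  have Kcl: "closedin W (K w)" for w by (simp add: K_def)
  have Ksub: "K w \<subseteq> slab W p {c..y}" if "w \<in> F" for w
    unfolding K_def
  proof (rule closure_of_minimal)
    show "E w \<subseteq> slab W p {c..y}" using Esub[OF that] by (auto simp: slab_def)
  qed (simp add: closedin_slab continuous)
  \<comment> \<open>Closing \<open>E w\<close> adds points only over \<open>c\<close>: the points
    higher than \<open>s\<close> and off the closed \<open>V s w\<close> form an open set that
    misses \<open>E w\<close>.\<close>
  have KE: "x \<in> V s w" if w: "w \<in> F" and x: "x \<in> K w" "s < p x" "c < s" for x s w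
  proof (rule ccontr)
    assume nx: "x \<notin> V s w"
    have xs: "x \<in> slab W p {c..y}" using Ksub[OF w] x(1) by blast
    then have s: "s \<in> {c<..y}" using x by (auto simp: slab_def)
    have "openin W (slab W p {s<..} - V s w)" by (intro openin_diff openin_slab continuous Vc s w) auto
    moreover have "x \<in> slab W p {s<..} - V s w" using nx xs x by (auto simp: slab_def)
    ultimately obtain z where z: "z \<in> E w" "z \<in> slab W p {s<..} - V s w"
      using x(1) unfolding K_def in_closure_of by blast
    then have "z \<in> slab W p {s..y}" using Esub[OF w] by (auto simp: slab_def)
    then show False using Eslab[OF s w] z by blast
  qed
  have sheet: "sheet W p c y (K w)" if w: "w \<in> F" for w
    unfolding sheet_def
  proof (intro conjI Kcl)
    \<comment> \<open>The image of the closure is closed and contains \<open>{c<..y}\<close>, hence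
      also \<open>c\<close>.\<close>
    have "closed (p ` K w)"
      using closed_map_real[OF compact continuous] Kcl by (auto simp: closed_map_def)
    moreover have "{c<..y} \<subseteq> p ` K w" using Eim[OF w] EK[OF w] by blast
    ultimately have "{c..y} \<subseteq> p ` K w" using closure_minimal cy closure_greaterThanAtMost by metis
    then show "p ` K w = {c..y}" using Ksub[OF w] by (auto simp: slab_def)
    show "inj_on p (K w)"
    proof (rule inj_onI, rule ccontr)
      fix x z assume xz: "x \<in> K w" "z \<in> K w" "p x = p z" "x \<noteq> z"
      have top: "x \<in> topspace W" "z \<in> topspace W" "c \<le> p x" using xz Ksub[OF w] by (auto simp: slab_def)
      show False
      proof (cases "p x = c")
        case False
        define s where "s = (c + p x) / 2"
        have s: "c < s" "s < p x" using False top by (auto simp: s_def)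
        moreover have "s \<in> {c<..y}" using Ksub[OF w] xz(1) s by (auto simp: slab_def)
        ultimately show False
          using KE[OF w xz(1) s(2) s(1)] KE[OF w xz(2) _ s(1)] xz Vc(2)[OF _ w] by (metis inj_onD)
      next
        case True
        \<comment> \<open>Two limit points over \<open>c\<close> are separated by a splitting of the
          fibre, which persists up to height \<open>c + d\<close>; both sides contain points of
          \<open>E w\<close> below that height.\<close>
        obtain A B where AB: "openin W A" "openin W B" "x \<in> A" "z \<in> B" "A \<inter> B = {}" "slab W p {c} \<subseteq> A \<union> B"
          using light[OF top(1,2) xz(4,3)] True by auto
        obtain d where d: "d > 0" "slab W p {c-d<..<c+d} \<subseteq> A \<union> B"
          using slab_tube[OF compact continuous openin_Un[OF AB(1,2)] AB(6)] by metis
        have meets: "\<exists>x'\<in>E w. x' \<in> T \<and> p x' < c + d" if T: "openin W T" "v \<in> T" "v \<in> K w" "p v = c" for T v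
        proof -
          have "openin W (T \<inter> slab W p {..<c+d})" by (intro openin_Int T openin_slab continuous) simp
          moreover have "v \<in> T \<inter> slab W p {..<c+d}"
            using T d(1) openin_subset[OF T(1)] by (auto simp: slab_iff)
          ultimately obtain x' where "x' \<in> E w" "x' \<in> T \<inter> slab W p {..<c+d}"
            using T(3) unfolding K_def in_closure_of by blast
          then show ?thesis by (auto simp: slab_iff)
        qed
        obtain x' where x': "x' \<in> E w" "x' \<in> A" "p x' < c + d"
          using meets[OF AB(1,3) xz(1) True] by blast
        obtain z' where z': "z' \<in> E w" "z' \<in> B" "p z' < c + d"
          using meets[OF AB(2,4) xz(2)] True xz(3) by auto
        define s where "s = min (p x') (p z')"
        define t where "t = max (p x') (p z')"
        have sl: "x' \<in> slab W p {c<..y}" "z' \<in> slab W p {c<..y}" using Esub[OF w] x' z' by auto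
        then have s: "s \<in> {c<..y}" by (auto simp: s_def slab_def)
        \<comment> \<open>The arc of the sheet from \<open>x'\<close> to \<open>z'\<close>. Both
          ends are lower than \<open>c + d\<close>, hence so is all of it, and \<open>A\<close>,
          \<open>B\<close> disconnect it.\<close>
        define C where "C = V s w \<inter> slab W p {s..t}"
        have "x' \<in> slab W p {s..y}" "z' \<in> slab W p {s..y}" using sl by (auto simp: s_def slab_def)
        then have "x' \<in> V s w" "z' \<in> V s w" using Eslab[OF s w] x' z' by blast+
        then have xC: "x' \<in> C" "z' \<in> C" using sl by (auto simp: C_def s_def t_def slab_def)
        have "t \<le> y" using sl by (auto simp: t_def slab_def)
        then have "sheet W p s t C"
          unfolding C_def by (intro sheet_restrict[OF continuous Vs[OF s w]]) auto
        then have "connectedin W C" by (rule sheet_connectedin[OF compact continuous])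
        moreover have "C \<subseteq> A \<union> B"
          using d(1) s x'(3) z'(3) by (intro subset_trans[OF _ d(2)]) (auto simp: C_def t_def slab_def)
        ultimately show False using AB xC x' z' connectedinD[of W C A B] by blast
      qed
    qed
  qed
  \<comment> \<open>Closures sharing a point above \<open>c\<close> share the sheet over
    \<open>{s..y}\<close> for a level \<open>s\<close> below that point; its unique point over
    \<open>y\<close> is both \<open>w\<close> and \<open>w'\<close>.\<close>
  have "w = w'" if w: "w \<in> F" "w' \<in> F" and x: "x \<in> K w" "x \<in> K w'" "x \<notin> slab W p {c}" for x w w'
  proof -
    define s where "s = (c + p x) / 2"
    have "c < p x" "p x \<le> y" using x Ksub[OF w(1)] by (force simp: slab_def)+
    then have s: "c < s" "s < p x" "s \<in> {c<..y}" by (auto simp: s_def)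
    have "V s w = V s w'"
      using uniq[OF s(3)] VM[OF s(3)] w KE[OF w(1) x(1) s(2,1)] KE[OF w(2) x(2) s(2,1)] by blast
    then show ?thesis using VM[OF s(3)] w Fp Vc(2)[OF s(3) w(1)] by (metis inj_onD)
  qed
  then have "\<forall>k\<in>K ` F. \<forall>l\<in>K ` F. k \<noteq> l \<longrightarrow> k \<inter> l \<subseteq> slab W p {c}" by blast
  moreover have "slab W p {c<..y} \<subseteq> \<Union>(K ` F)"
  proof
    fix x assume x: "x \<in> slab W p {c<..y}"
    then have s: "p x \<in> {c<..y}" by (simp add: slab_def)
    have "x \<in> \<Union>(\<V> (p x))" using V0[OF s] x by (auto simp: slab_def)
    then obtain k where k: "k \<in> \<V> (p x)" "x \<in> k" by auto
    then have sh: "sheet W p (p x) y k" using V0[OF s] by blast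
    then have "y \<in> p ` k" using s by (auto simp: sheet_def)
    then obtain z where z: "z \<in> k" "p z = y" by auto
    then have zF: "z \<in> F" using sh closedin_subset by (fastforce simp: F_def slab_def sheet_def)
    then have "k = V (p x) z" using uniq[OF s k(1) _ z(1)] VM[OF s zF] by auto
    then have "x \<in> E z" using k s by (auto simp: E_def)
    then show "x \<in> \<Union>(K ` F)" using EK[OF zF] zF by blast
  qed
  ultimately show ?thesis using F sheet by (intro exI[of _ "K ` F"]) auto
qed

text \<open>The reflection of \<open>one_sided_sheets\<close>, applied to
  \<open>- p\<close>.\<close>

lemma one_sided_sheets_left:
  assumes "y < c" and "{y..<c} \<inter> S = {}"
  shows "\<exists>\<K>. finite \<K> \<and> (\<forall>K\<in>\<K>. sheet W p y c K) \<and>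
    (\<forall>K\<in>\<K>. \<forall>L\<in>\<K>. K \<noteq> L \<longrightarrow> K \<inter> L \<subseteq> slab W p {c}) \<and> slab W p {y..<c} \<subseteq> \<Union>\<K>"
proof -
  interpret N: tame_map W "\<lambda>x. - p x" "uminus ` S" by (rule tame_map_uminus) (rule tame_map_axioms)
  have "slab W (\<lambda>x. - p x) {- c} = slab W p {c}" "slab W (\<lambda>x. - p x) {- c<..- y} = slab W p {y..<c}"
    by (auto simp: slab_def)
  moreover have "{- c<..- y} \<inter> uminus ` S = {}" using assms(2) by fastforce
  ultimately show ?thesis using N.one_sided_sheets[of "- c" "- y"] assms(1) sheet_uminus by (simp add: sheet_uminus)
qed

section \<open>Finiteness of all fibres\<close>

lemma exceptional_gap:
  obtains d where "d > 0" "\<And>s. \<bar>s - c\<bar> < d \<Longrightarrow> s \<noteq> c \<Longrightarrow> s \<notin> S"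
proof -
  obtain d where "d > 0" "\<forall>x\<in>S. x \<noteq> c \<longrightarrow> d \<le> dist c x"
    using finite_set_avoid[OF finite_exceptional, of c] by blast
  then show thesis by (intro that[of d]) (force simp: dist_real_def)+
qed

lemma finite_fibre: "finite (slab W p {c})"
proof -
  obtain d where d: "d > 0" "\<And>s. \<bar>s - c\<bar> < d \<Longrightarrow> s \<noteq> c \<Longrightarrow> s \<notin> S" using exceptional_gap[of c] by blast
  define y where "y = c + d / 2"
  define y' where "y' = c - d / 2"
  have y: "y' < c" "c < y" using d by (auto simp: y_def y'_def)
  have "s \<notin> S" if "s \<in> {c<..y} \<union> {y'..<c}" for s
    using d(2)[of s] that d(1) by (auto simp: y_def y'_def abs_less_iff field_simps)
  then have "{c<..y} \<inter> S = {}" "{y'..<c} \<inter> S = {}" by blast+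
  then obtain \<K> \<L> where K: "finite \<K>" "\<And>K. K\<in>\<K> \<Longrightarrow> sheet W p c y K" "slab W p {c<..y} \<subseteq> \<Union>\<K>"
    and L: "finite \<L>" "\<And>K. K\<in>\<L> \<Longrightarrow> sheet W p y' c K" "slab W p {y'..<c} \<subseteq> \<Union>\<L>"
    using one_sided_sheets[of c y] one_sided_sheets_left[of y' c] y by metis
  define \<M> where "\<M> = \<K> \<union> \<L>"
  have M: "finite \<M>" "\<And>K. K \<in> \<M> \<Longrightarrow> closedin W K \<and> inj_on p K"
    using K L by (auto simp: \<M>_def sheet_def)
  \<comment> \<open>The feet over \<open>c\<close> of the sheets from both sides; by injectivity
    each sheet has at most one.\<close>
  define T where "T = slab W p {c} \<inter> \<Union>\<M>"
  have "finite (slab W p {c} \<inter> K)" if "K \<in> \<M>" for K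
  proof (rule finite_imageD)
    show "finite (p ` (slab W p {c} \<inter> K))" by (rule finite_subset[of _ "{c}"]) (auto simp: slab_def)
    show "inj_on p (slab W p {c} \<inter> K)" using M(2)[OF that] by (auto simp: inj_on_def)
  qed
  then have T: "finite T" unfolding T_def Int_Union using M(1) by (intro finite_UN_I) auto
  have single: "Y = {w}" if w: "w \<in> slab W p {c} - T" and Y: "connectedin W Y" "w \<in> Y" for w Y
  proof -
    have wt: "w \<in> topspace W" "p w = c" "w \<notin> T" using w by (auto simp: slab_def)
    have "\<exists>A B. openin W A \<and> openin W B \<and> w \<in> A \<and> z \<in> B \<and> A \<inter> B = {} \<and> slab W p {c} \<subseteq> A \<union> B" if "z \<in> T" for z
      using light[of w z] wt that by (auto simp: T_def slab_def)
    then obtain A B where AB: "\<And>z. z \<in> T \<Longrightarrow> openin W (A z) \<and> openin W (B z) \<and> w \<in> A z \<and> z \<in> B z \<and>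
        A z \<inter> B z = {} \<and> slab W p {c} \<subseteq> A z \<union> B z" by metis
    \<comment> \<open>What is left of the fibre after removing an open neighbourhood of
      \<open>T\<close>, hence closed. It turns out to be open as well, so it contains every
      connected set through \<open>w\<close>.\<close>
    define D where "D = slab W p {c} - (\<Union>z\<in>T. B z)"
    have "openin W (\<Union>z\<in>T. B z)" using AB by blast
    then have "closedin W D" unfolding D_def by (simp add: closedin_diff closedin_slab continuous)
    moreover have "openin W D"
    proof -
      \<comment> \<open>Over \<open>{y'<..<y}\<close> every point off level \<open>c\<close> lies on
        a sheet. Removing the finitely many closed sheets thus leaves only points of the fibre, and
        yet an open subset of \<open>W\<close>.\<close>
      define G where "G = slab W p {y'<..<y} - \<Union>\<M>"
      have "openin W G" unfolding G_def using M
        by (intro openin_diff openin_slab continuous closedin_Union) auto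
      moreover have G: "G = slab W p {c} - T"
      proof
        have "x \<in> slab W p {c<..y} \<or> x \<in> slab W p {y'..<c} \<or> x \<in> slab W p {c}" if "x \<in> slab W p {y'<..<y}" for x
          using that by (auto simp: slab_def)
        then show "G \<subseteq> slab W p {c} - T" using K(3) L(3) by (fastforce simp: G_def T_def \<M>_def)
        show "slab W p {c} - T \<subseteq> G" using y by (auto simp: G_def T_def slab_def)
      qed
      moreover have "D = (if T = {} then G else G \<inter> (\<Inter>z\<in>T. A z))"
        using AB unfolding G D_def by (auto 4 3)
      moreover have "openin W (\<Inter>z\<in>T. A z)" if "T \<noteq> {}" using AB T that by (intro openin_INT2) auto
      ultimately show ?thesis by auto
    qed
    moreover have "w \<in> D" using AB w by (auto simp: D_def)
    ultimately have "Y \<subseteq> D" using connectedin_clopen_cases[OF Y(1)] Y(2) by (auto simp: disjnt_def)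
    then have Yc: "Y \<subseteq> slab W p {c}" by (auto simp: D_def)
    \<comment> \<open>Now \<open>Y\<close> lies in one fibre, where \<open>light\<close> disconnects
      any two points.\<close>
    have False if v: "v \<in> Y" "v \<noteq> w" for v
    proof -
      have "v \<in> topspace W" "p w = p v" using v Yc wt by (auto simp: slab_def)
      then obtain A B where "openin W A" "openin W B" "w \<in> A" "v \<in> B" "A \<inter> B = {}" "slab W p {c} \<subseteq> A \<union> B"
        using light[of w v] wt v by auto
      then show False using connectedinD[OF Y(1), of A B] Yc Y(2) v by blast
    qed
    then show ?thesis using Y(2) by blast
  qed
  obtain \<Y> where \<Y>: "finite \<Y>" "\<forall>Y\<in>\<Y>. connectedin W Y" "topspace W \<subseteq> \<Union>\<Y>"
    using finite_connected_cover by blast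
  \<comment> \<open>Each point off \<open>T\<close> forces its own singleton into the finite
    cover.\<close>
  have "slab W p {c} - T \<subseteq> (\<lambda>w. {w}) -` \<Y>"
  proof
    fix w assume w: "w \<in> slab W p {c} - T"
    then have "w \<in> \<Union>\<Y>" using \<Y>(3) by (auto simp: slab_def)
    then obtain Y where Y: "Y \<in> \<Y>" "w \<in> Y" by blast
    then have "Y = {w}" using single[OF w] \<Y>(2) by blast
    then show "w \<in> (\<lambda>w. {w}) -` \<Y>" using Y by simp
  qed
  moreover have "finite ((\<lambda>w. {w}) -` \<Y>)" by (rule finite_vimageI[OF \<Y>(1)]) simp
  ultimately have "finite (slab W p {c} - T)" by (rule finite_subset)
  then show ?thesis using T by simp
qed

end

section \<open>Arcs and the assembly of the graph\<close>

text \<open>The arc is the inverse of \<open>p\<close> on \<open>K\<close> after the affine map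
  \<open>h\<close> from \<open>{0..1}\<close> onto \<open>{c..d}\<close>. Its inverse
  \<open>k \<circ> p\<close> is continuous on all of \<open>W\<close>, which gives the embedding of
  the open interval.\<close>

lemma sheet_arc:
  fixes W :: "'w topology"
  assumes "compact_space W" "continuous_map W euclideanreal p" and sh: "sheet W p c d K" and cd: "c < d"
  shows "\<exists>\<gamma> :: real \<Rightarrow> 'w. continuous_map (top_of_set {0..1}) W \<gamma> \<and> embedding_map (top_of_set {0<..<1}) W \<gamma> \<and>
    \<gamma> ` {0..1} = K \<and> \<gamma> ` {0<..<1} = K - slab W p {c, d} \<and> \<gamma> 0 \<in> K \<inter> slab W p {c, d} \<and> \<gamma> 1 \<in> K \<inter> slab W p {c, d}"
proof -
  have K: "closedin W K" "inj_on p K" "p ` K = {c..d}" "K \<subseteq> topspace W"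
    using sh by (auto simp: sheet_def closedin_subset)
  obtain g where g: "homeomorphic_maps (subtopology W K) (top_of_set {c..d}) p g"
    using sheet_homeomorphic_map[OF assms(1,2) sh] homeomorphic_map_maps by blast
  then have gc: "continuous_map (top_of_set {c..d}) (subtopology W K) g"
    and gp: "\<And>x. x \<in> K \<Longrightarrow> g (p x) = x" and pg: "\<And>t. t \<in> {c..d} \<Longrightarrow> p (g t) = t"
    using K(4) by (auto simp: homeomorphic_maps_def Int_absorb1)
  have gK: "g t \<in> K" if "t \<in> {c..d}" for t
    using continuous_map_image_subset_topspace[OF gc] that K(4) by auto
  define h where "h t = c + t * (d - c)" for t
  define k where "k s = (s - c) / (d - c)" for s
  have kh: "k (h t) = t" "h (k s) = s" for t s using cd by (auto simp: h_def k_def)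
  have h01: "h t \<in> {c..d} \<longleftrightarrow> t \<in> {0..1}" "h t \<in> {c<..<d} \<longleftrightarrow> t \<in> {0<..<1}" for t
  proof -
    have "h t - c = t * (d - c)" "d - h t = (1 - t) * (d - c)" by (simp_all add: h_def algebra_simps)
    then have "c \<le> h t \<longleftrightarrow> 0 \<le> t * (d - c)" "c < h t \<longleftrightarrow> 0 < t * (d - c)"
      "h t \<le> d \<longleftrightarrow> 0 \<le> (1 - t) * (d - c)" "h t < d \<longleftrightarrow> 0 < (1 - t) * (d - c)"
      by linarith+
    then show "h t \<in> {c..d} \<longleftrightarrow> t \<in> {0..1}" "h t \<in> {c<..<d} \<longleftrightarrow> t \<in> {0<..<1}"
      using cd by (simp_all add: zero_le_mult_iff zero_less_mult_iff)
  qed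
  have hc: "continuous_on T h" "continuous_on T k" for T
    using cd unfolding h_def k_def by (auto intro!: continuous_intros)
  define \<gamma> where "\<gamma> t = g (h t)" for t
  have p\<gamma>: "p (\<gamma> t) = h t" "\<gamma> t \<in> K" if "t \<in> {0..1}" for t
    using pg gK h01(1)[of t] that by (auto simp: \<gamma>_def)
  have \<gamma>p: "\<gamma> (k (p x)) = x" "p x \<in> {c..d}" if "x \<in> K" for x
    using gp[OF that] that K(3) by (auto simp: \<gamma>_def kh)
  have kp: "k (p x) \<in> {0..1}" if "x \<in> K" for x
    using \<gamma>p(2)[OF that] h01(1)[of "k (p x)"] by (simp add: kh)
  have kp': "k (p x) \<in> {0<..<1}" if "x \<in> K" "p x \<noteq> c" "p x \<noteq> d" for x
    using \<gamma>p(2)[OF that(1)] h01(2)[of "k (p x)"] that by (auto simp: kh)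
  have "continuous_map (top_of_set {0..1}) (subtopology W K) (g \<circ> h)"
    by (rule continuous_map_compose[OF _ gc]) (use hc h01 in auto)
  then have \<gamma>c: "continuous_map (top_of_set {0..1}) W \<gamma>"
    by (simp add: \<gamma>_def[abs_def] o_def continuous_map_in_subtopology)
  have im1: "\<gamma> ` {0..1} = K"
  proof
    show "K \<subseteq> \<gamma> ` {0..1}"
      using \<gamma>p(1) kp by (metis image_iff subsetI)
  qed (use p\<gamma> in auto)
  have im2: "\<gamma> ` {0<..<1} = K - slab W p {c, d}"
  proof
    show "\<gamma> ` {0<..<1} \<subseteq> K - slab W p {c, d}"
    proof
      fix x assume "x \<in> \<gamma> ` {0<..<1}"
      then obtain t where t: "t \<in> {0<..<1}" "x = \<gamma> t" by blast
      then show "x \<in> K - slab W p {c, d}" using h01(2)[of t] p\<gamma>[of t] by (auto simp: slab_def)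
    qed
    show "K - slab W p {c, d} \<subseteq> \<gamma> ` {0<..<1}"
    proof
      fix x assume x: "x \<in> K - slab W p {c, d}"
      then have "k (p x) \<in> {0<..<1}" using kp'[of x] K(4) by (auto simp: slab_def)
      then show "x \<in> \<gamma> ` {0<..<1}" using \<gamma>p(1)[of x] x by (metis DiffD1 image_iff)
    qed
  qed
  have "homeomorphic_maps (top_of_set {0<..<1}) (subtopology W (\<gamma> ` {0<..<1})) \<gamma> (k \<circ> p)"
    unfolding homeomorphic_maps_def
  proof (intro conjI ballI)
    show "continuous_map (top_of_set {0<..<1}) (subtopology W (\<gamma> ` {0<..<1})) \<gamma>"
      using continuous_map_from_subtopology_mono[OF \<gamma>c, of "{0<..<1}"]
      by (simp add: continuous_map_in_subtopology greaterThanLessThan_subseteq_atLeastAtMost_iff)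
    have "continuous_map W euclideanreal (k \<circ> p)"
      by (rule continuous_map_compose[OF assms(2)]) (use hc in auto)
    then show "continuous_map (subtopology W (\<gamma> ` {0<..<1})) (top_of_set {0<..<1}) (k \<circ> p)"
      using kp' unfolding im2
      by (auto simp: continuous_map_in_subtopology continuous_map_from_subtopology slab_def)
    show "(k \<circ> p) (\<gamma> x) = x" if "x \<in> topspace (top_of_set {0<..<1})" for x
      using p\<gamma>[of x] that by (simp add: kh)
    show "\<gamma> ((k \<circ> p) y) = y" if "y \<in> topspace (subtopology W (\<gamma> ` {0<..<1}))" for y
      using \<gamma>p(1)[of y] that unfolding im2 by simp
  qed
  then have emb: "embedding_map (top_of_set {0<..<1}) W \<gamma>"
    unfolding embedding_map_def using homeomorphic_maps_map by fastforce
  have "h 0 = c" "h 1 = d" by (auto simp: h_def)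
  then have "\<gamma> 0 \<in> K \<inter> slab W p {c, d}" "\<gamma> 1 \<in> K \<inter> slab W p {c, d}"
    using p\<gamma>[of 0] p\<gamma>[of 1] K(4) by (auto simp: slab_def)
  then show ?thesis using \<gamma>c emb im1 im2 by blast
qed

text \<open>A graph structure on a slab whose edges are still sheets, so that \<open>p\<close>
  embeds each of them. All points over \<open>a\<close> and \<open>b\<close> must be vertices, which
  lets adjacent slabs be joined; an edge meets \<open>V\<close> only in its two ends.\<close>

definition graph_over :: "'w topology \<Rightarrow> ('w \<Rightarrow> real) \<Rightarrow> real \<Rightarrow> real \<Rightarrow> bool" where
  "graph_over W p a b \<longleftrightarrow> (\<exists>V \<K>. finite V \<and> finite \<K> \<and> slab W p {a, b} \<subseteq> V \<and> V \<subseteq> slab W p {a..b} \<and>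
     (\<forall>K\<in>\<K>. \<exists>c d. a \<le> c \<and> c < d \<and> d \<le> b \<and> sheet W p c d K \<and> K \<inter> V = K \<inter> slab W p {c, d}) \<and>
     (\<forall>K\<in>\<K>. \<forall>L\<in>\<K>. K \<noteq> L \<longrightarrow> K \<inter> L \<subseteq> V) \<and> slab W p {a..b} = V \<union> \<Union>\<K>)"

text \<open>In contrast to \<open>sheeted_trans\<close> no edges are merged: what the two sides
  share lies over \<open>b\<close>, where every point is a vertex of both.\<close>

lemma graph_over_trans:
  assumes "graph_over W p a b" "graph_over W p b c" "a \<le> b" "b \<le> c"
  shows "graph_over W p a c"
proof -
  obtain V \<K> where V: "finite V" "finite \<K>" "slab W p {a, b} \<subseteq> V" "V \<subseteq> slab W p {a..b}"
      "slab W p {a..b} = V \<union> \<Union>\<K>"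
    and Vs: "\<And>K. K\<in>\<K> \<Longrightarrow> \<exists>c d. a \<le> c \<and> c < d \<and> d \<le> b \<and> sheet W p c d K \<and> K \<inter> V = K \<inter> slab W p {c, d}"
    and Vd: "\<And>K L. K\<in>\<K> \<Longrightarrow> L \<in> \<K> \<Longrightarrow> K \<noteq> L \<Longrightarrow> K \<inter> L \<subseteq> V"
    using assms(1) unfolding graph_over_def by metis
  obtain U \<L> where U: "finite U" "finite \<L>" "slab W p {b, c} \<subseteq> U" "U \<subseteq> slab W p {b..c}"
      "slab W p {b..c} = U \<union> \<Union>\<L>"
    and Us: "\<And>K. K\<in>\<L> \<Longrightarrow> \<exists>c' d. b \<le> c' \<and> c' < d \<and> d \<le> c \<and> sheet W p c' d K \<and> K \<inter> U = K \<inter> slab W p {c', d}"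
    and Ud: "\<And>K L. K\<in>\<L> \<Longrightarrow> L \<in> \<L> \<Longrightarrow> K \<noteq> L \<Longrightarrow> K \<inter> L \<subseteq> U"
    using assms(2) unfolding graph_over_def by metis
  have Ksub: "K \<subseteq> slab W p {a..b}" if "K \<in> \<K>" for K using V(5) that by blast
  have Lsub: "L \<subseteq> slab W p {b..c}" if "L \<in> \<L>" for L using U(5) that by blast
  have mid: "slab W p {a..b} \<inter> slab W p {b..c} \<subseteq> V \<inter> U"
    using V(3) U(3) by (fastforce simp: slab_def)
  show ?thesis unfolding graph_over_def
  proof (rule exI[of _ "V \<union> U"], rule exI[of _ "\<K> \<union> \<L>"], intro conjI ballI impI)
    show "finite (V \<union> U)" "finite (\<K> \<union> \<L>)" using V U by auto
    show "slab W p {a, c} \<subseteq> V \<union> U" using V U by (fastforce simp: slab_def)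
    have un: "slab W p {a..c} = slab W p {a..b} \<union> slab W p {b..c}"
      using assms(3,4) by (auto simp: slab_def)
    show "V \<union> U \<subseteq> slab W p {a..c}" using un V U by blast
    show "slab W p {a..c} = V \<union> U \<union> \<Union>(\<K> \<union> \<L>)" using un V(5) U(5) by blast
    fix K assume "K \<in> \<K> \<union> \<L>"
    then show "\<exists>c' d. a \<le> c' \<and> c' < d \<and> d \<le> c \<and> sheet W p c' d K \<and> K \<inter> (V \<union> U) = K \<inter> slab W p {c', d}"
    proof
      assume K: "K \<in> \<K>"
      then have "K \<inter> (V \<union> U) = K \<inter> V" using Ksub[OF K] U(4) mid by blast
      then show ?thesis using Vs[OF K] assms(4) by (metis order_trans)
    next
      assume K: "K \<in> \<L>"
      then have "K \<inter> (V \<union> U) = K \<inter> U" using Lsub[OF K] V(4) mid by blast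
      then show ?thesis using Us[OF K] assms(3) by (metis order_trans)
    qed
  next
    fix K L assume "K \<in> \<K> \<union> \<L>" "L \<in> \<K> \<union> \<L>" "K \<noteq> L"
    then show "K \<inter> L \<subseteq> V \<union> U" using Vd Ud Ksub Lsub mid by (elim UnE) blast+
  qed
qed

context tame_map
begin

lemma graph_over_one_sided:
  assumes "c \<le> y" "{c<..y} \<inter> S = {} \<or> {c..<y} \<inter> S = {}"
  shows "graph_over W p c y"
proof (cases "c = y")
  case True
  then show ?thesis
    unfolding graph_over_def by (intro exI[of _ "slab W p {c}"] exI[of _ "{}"]) (auto simp: finite_fibre)
next
  case False
  with assms have cy: "c < y" by simp
  \<comment> \<open>\<open>e\<close> is the end that may belong to \<open>S\<close>, the only level
    at which different sheets can touch. Both end fibres become vertices, finite by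
    \<open>finite_fibre\<close>.\<close>
  have "\<exists>\<K> e. e \<in> {c, y} \<and> finite \<K> \<and> (\<forall>K\<in>\<K>. sheet W p c y K) \<and>
    (\<forall>K\<in>\<K>. \<forall>L\<in>\<K>. K \<noteq> L \<longrightarrow> K \<inter> L \<subseteq> slab W p {e}) \<and> slab W p {c<..<y} \<subseteq> \<Union>\<K>"
    using assms(2)
  proof
    assume "{c<..y} \<inter> S = {}"
    moreover have "slab W p {c<..<y} \<subseteq> slab W p {c<..y}" by (auto simp: slab_def)
    ultimately show ?thesis using one_sided_sheets[OF cy] by (meson insertI1 subset_trans)
  next
    assume "{c..<y} \<inter> S = {}"
    moreover have "slab W p {c<..<y} \<subseteq> slab W p {c..<y}" by (auto simp: slab_def)
    ultimately show ?thesis using one_sided_sheets_left[OF cy] by (meson insertI1 insertI2 subset_trans)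
  qed
  then obtain \<K> e where K: "e \<in> {c, y}" "finite \<K>" "\<forall>K\<in>\<K>. sheet W p c y K"
    "\<forall>K\<in>\<K>. \<forall>L\<in>\<K>. K \<noteq> L \<longrightarrow> K \<inter> L \<subseteq> slab W p {e}" "slab W p {c<..<y} \<subseteq> \<Union>\<K>" by metis
  have V: "slab W p {c, y} = slab W p {c} \<union> slab W p {y}" by (auto simp: slab_def)
  have e: "slab W p {e} \<subseteq> slab W p {c, y}" using K(1) by (auto simp: slab_def)
  have Ksub: "K \<subseteq> slab W p {c..y}" if "K \<in> \<K>" for K
  proof -
    have "closedin W K" "p ` K = {c..y}" using K(3) that by (auto simp: sheet_def)
    then have "K \<subseteq> topspace W" "p ` K = {c..y}" by (simp_all add: closedin_subset)
    then show ?thesis by (auto simp: slab_def)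
  qed
  show ?thesis
    unfolding graph_over_def
  proof (intro exI[of _ "slab W p {c, y}"] exI[of _ \<K>] conjI ballI impI)
    show "finite (slab W p {c, y})" using V finite_fibre by simp
    show "slab W p {c, y} \<subseteq> slab W p {c..y}" using cy by (auto simp: slab_def)
    have "slab W p {c..y} = slab W p {c, y} \<union> slab W p {c<..<y}" using cy by (auto simp: slab_def)
    then show "slab W p {c..y} = slab W p {c, y} \<union> \<Union>\<K>" using K(5) Ksub by blast
    show "K \<inter> L \<subseteq> slab W p {c, y}" if "K \<in> \<K>" "L \<in> \<K>" "K \<noteq> L" for K L using K(4) that e by blast
    show "\<exists>c' d. c \<le> c' \<and> c' < d \<and> d \<le> y \<and> sheet W p c' d k \<and> k \<inter> slab W p {c, y} = k \<inter> slab W p {c', d}"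
      if "k \<in> \<K>" for k using K(3) that cy by blast
  qed (use K in auto)
qed

text \<open>A short interval containing \<open>x\<close> splits at \<open>x\<close> into two pieces,
  neither of which meets \<open>S\<close> except possibly at \<open>x\<close>.\<close>

lemma graph_over:
  assumes "a \<le> b"
  shows "graph_over W p a b"
  using assms
proof (induction rule: Bolzano)
  case (trans a b c)
  then show ?case using graph_over_trans by metis
next
  case (local x)
  obtain d where d: "d > 0" "\<And>s. \<bar>s - x\<bar> < d \<Longrightarrow> s \<noteq> x \<Longrightarrow> s \<notin> S" using exceptional_gap[of x] by blast
  show ?case
  proof (intro exI[of _ d] conjI allI impI d(1))
    fix a b assume ab: "a \<le> x \<and> x \<le> b \<and> b - a < d"
    then have "{x<..b} \<inter> S = {}" "{a..<x} \<inter> S = {}" using d(2) by force+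
    then show "graph_over W p a b" using ab graph_over_one_sided graph_over_trans by metis
  qed
qed

theorem graph_structure_edges_embedded:
  "\<exists>V G. graph_structure W V G \<and> (\<forall>e\<in>edges G. embedding_map (subtopology W e) euclideanreal p)"
proof -
  have "compactin euclideanreal (p ` topspace W)"
    by (rule image_compactin[OF _ continuous]) (use compact in \<open>simp add: compact_space_def\<close>)
  then have "bounded (p ` topspace W)" by (simp add: compact_imp_bounded)
  then obtain B where B: "\<And>x. x \<in> topspace W \<Longrightarrow> \<bar>p x\<bar> \<le> B" by (auto simp: bounded_iff)
  \<comment> \<open>\<open>B\<close> may be negative if \<open>W\<close> is empty;
    \<open>\<bar>B\<bar>\<close> keeps the interval nonempty.\<close>
  have top: "topspace W = slab W p {-\<bar>B\<bar>..\<bar>B\<bar>}" 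
  proof (intro equalityI subsetI)
    fix x assume "x \<in> topspace W"
    then have "- \<bar>B\<bar> \<le> p x" "p x \<le> \<bar>B\<bar>" using B[of x] by linarith+
    then show "x \<in> slab W p {-\<bar>B\<bar>..\<bar>B\<bar>}" using \<open>x \<in> topspace W\<close> by (simp add: slab_iff)
  qed (simp add: slab_iff)
  have "graph_over W p (-\<bar>B\<bar>) \<bar>B\<bar>" by (rule graph_over) simp
  then obtain V \<K> where VK: "finite V \<and> finite \<K> \<and> slab W p {-\<bar>B\<bar>, \<bar>B\<bar>} \<subseteq> V \<and> V \<subseteq> slab W p {-\<bar>B\<bar>..\<bar>B\<bar>} \<and>
     (\<forall>K\<in>\<K>. \<exists>c d. -\<bar>B\<bar> \<le> c \<and> c < d \<and> d \<le> \<bar>B\<bar> \<and> sheet W p c d K \<and> K \<inter> V = K \<inter> slab W p {c, d}) \<and>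
     (\<forall>K\<in>\<K>. \<forall>L\<in>\<K>. K \<noteq> L \<longrightarrow> K \<inter> L \<subseteq> V) \<and> slab W p {-\<bar>B\<bar>..\<bar>B\<bar>} = V \<union> \<Union>\<K>"
    unfolding graph_over_def by (elim exE)
  then have V: "finite V" "finite \<K>" "V \<subseteq> topspace W" "topspace W = V \<union> \<Union>\<K>"
    and Vs': "\<forall>K\<in>\<K>. \<exists>c d. - \<bar>B\<bar> \<le> c \<and> c < d \<and> d \<le> \<bar>B\<bar> \<and> sheet W p c d K \<and> K \<inter> V = K \<inter> slab W p {c, d}"
    and Vd: "\<And>K L. K\<in>\<K> \<Longrightarrow> L \<in> \<K> \<Longrightarrow> K \<noteq> L \<Longrightarrow> K \<inter> L \<subseteq> V"
    unfolding top by simp_all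
  have Vs: "\<exists>c d. c < d \<and> sheet W p c d K \<and> K \<inter> V = K \<inter> slab W p {c, d}" if "K \<in> \<K>" for K
    using Vs' that by blast
  have "\<exists>\<gamma> :: real \<Rightarrow> 'w. continuous_map (top_of_set {0..1}) W \<gamma> \<and> embedding_map (top_of_set {0<..<1}) W \<gamma> \<and>
    \<gamma> ` {0..1} = K \<and> \<gamma> ` {0<..<1} = K - V \<and> \<gamma> 0 \<in> V \<and> \<gamma> 1 \<in> V" if K: "K \<in> \<K>" for K
  proof -
    obtain c d where cd: "c < d" "sheet W p c d K" "K \<inter> V = K \<inter> slab W p {c, d}" using Vs[OF K] by blast
    moreover have "K - V = K - slab W p {c, d}" using cd(3) by blast
    moreover have "x \<in> V" if "x \<in> K \<inter> slab W p {c, d}" for x using that cd(3) by blast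
    ultimately show ?thesis using sheet_arc[OF compact continuous cd(2,1)] by auto
  qed
  then have "\<forall>K\<in>\<K>. \<exists>\<gamma> :: real \<Rightarrow> 'w. continuous_map (top_of_set {0..1}) W \<gamma> \<and> embedding_map (top_of_set {0<..<1}) W \<gamma> \<and>
    \<gamma> ` {0..1} = K \<and> \<gamma> ` {0<..<1} = K - V \<and> \<gamma> 0 \<in> V \<and> \<gamma> 1 \<in> V" by (rule ballI)
  from bchoice[OF this] obtain \<gamma> :: "'w set \<Rightarrow> real \<Rightarrow> 'w" where \<gamma>: "\<forall>K\<in>\<K>. continuous_map (top_of_set {0..1}) W (\<gamma> K) \<and>
     embedding_map (top_of_set {0<..<1}) W (\<gamma> K) \<and>
     \<gamma> K ` {0..1} = K \<and> \<gamma> K ` {0<..<1} = K - V \<and> \<gamma> K 0 \<in> V \<and> \<gamma> K 1 \<in> V" by (elim exE)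
  note \<gamma> = \<gamma>[rule_format]
  have "graph_structure W V (\<gamma> ` \<K>)"
    unfolding graph_structure_def
  proof (intro conjI ballI impI Hausdorff V(1))
    show "finite (\<gamma> ` \<K>)" using V(2) by simp
    show "topspace W = V \<union> (\<Union>g\<in>\<gamma> ` \<K>. g ` {0<..<1})" using V(3,4) \<gamma> by auto
    fix g assume "g \<in> \<gamma> ` \<K>"
    then obtain K where K: "K \<in> \<K>" "g = \<gamma> K" by blast
    then show "continuous_map (top_of_set {0..1}) W g" "g 0 \<in> V" "g 1 \<in> V"
      "embedding_map (top_of_set {0<..<1}) W g" "g ` {0<..<1} \<inter> V = {}" using \<gamma>[OF K(1)] by auto
    fix h assume h: "h \<in> \<gamma> ` \<K>" "g \<noteq> h"
    then obtain L where L: "L \<in> \<K>" "h = \<gamma> L" by blast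
    then show "g ` {0<..<1} \<inter> h ` {0<..<1} = {}" using \<gamma>[OF K(1)] \<gamma>[OF L(1)] Vd[OF K(1) L(1)] K(2) h(2) by auto
  qed
  moreover have "embedding_map (subtopology W e) euclideanreal p" if "e \<in> edges (\<gamma> ` \<K>)" for e
  proof -
    have e: "e \<in> \<K>" using that \<gamma> by (auto simp: edges_def)
    then obtain c d where "sheet W p c d e" using Vs by blast
    moreover from this have "topspace (subtopology W e) = e" "p ` e = {c..d}"
      by (auto simp: sheet_def closedin_subset Int_absorb1)
    ultimately show ?thesis
      unfolding embedding_map_def using sheet_homeomorphic_map[OF compact continuous] by simp
  qed
  ultimately show ?thesis by blast
qed

end

section \<open>The Reeb space of a function on a compact Hausdorff space\<close>

text \<open>The assumptions \<open>locally_inj\<close> and \<open>locally_open\<close> of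
  \<open>tame_map\<close>, expressed in \<open>X\<close> before passing to the quotient and free of
  charts.\<close>

definition reeb_regular :: "'a topology \<Rightarrow> ('a \<Rightarrow> real) \<Rightarrow> 'a \<Rightarrow> bool" where
  "reeb_regular X f x \<longleftrightarrow>
     (\<exists>B. openin X B \<and> x \<in> B \<and> (\<forall>y\<in>B. \<forall>z\<in>B. f y = f z \<longrightarrow> (y, z) \<in> reeb_rel X f)) \<and>
     (\<forall>B. openin X B \<and> x \<in> B \<longrightarrow> (\<exists>d>0. {f x - d<..<f x + d} \<subseteq> f ` B))"

lemma reeb_rel_sym: "(x, y) \<in> reeb_rel X f \<Longrightarrow> (y, x) \<in> reeb_rel X f"
  using equiv_reeb_rel by (metis equivE symD)

lemma reeb_rel_trans: "(x, y) \<in> reeb_rel X f \<Longrightarrow> (y, z) \<in> reeb_rel X f \<Longrightarrow> (x, z) \<in> reeb_rel X f"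
  using equiv_reeb_rel by (metis equivE transD)

lemma reeb_quotient_eq_iff:
  "\<lbrakk>x \<in> topspace X; y \<in> topspace X\<rbrakk> \<Longrightarrow> reeb_quotient X f x = reeb_quotient X f y \<longleftrightarrow> (x, y) \<in> reeb_rel X f"
  unfolding reeb_quotient_def by (rule eq_equiv_class_iff[OF equiv_reeb_rel])

lemma topspace_reeb_space_image: "topspace (reeb_space X f) = reeb_quotient X f ` topspace X"
  by (simp add: reeb_space_def)

lemma continuous_map_reeb_quotient: "continuous_map X (reeb_space X f) (reeb_quotient X f)"
  unfolding reeb_space_def by (rule quotient_imp_continuous_map[OF quotient_map_quotient_topology])

lemma reeb_relI:
  assumes "connectedin X Z" "\<And>z. z \<in> Z \<Longrightarrow> f z = c" "x \<in> Z" "y \<in> Z"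
  shows "(x, y) \<in> reeb_rel X f"
proof -
  have "Z \<subseteq> topspace X" using assms(1) connectedin_subset_topspace by blast
  moreover from this have "connectedin (subtopology X {z \<in> topspace X. f z = f x}) Z"
    using assms by (auto simp: connectedin_subtopology)
  ultimately show ?thesis using assms by (auto simp: reeb_rel_def connected_component_of_def)
qed

lemma reeb_quotient_eq_component:
  assumes "x \<in> topspace X"
  shows "reeb_quotient X f x = connected_component_of_set (subtopology X (slab X f {f x})) x"
proof -
  have eq: "{z \<in> topspace X. f z = f x} = slab X f {f x}" by (simp add: slab_def)
  have "y \<in> topspace X \<and> f y = f x" if "connected_component_of (subtopology X (slab X f {f x})) x y" for y
    using connected_component_in_topspace[OF that] by (simp add: slab_iff)
  then have "y \<in> reeb_quotient X f x \<longleftrightarrow> connected_component_of (subtopology X (slab X f {f x})) x y" for y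
    unfolding reeb_quotient_def reeb_rel_def Image_singleton_iff mem_Collect_eq prod.case eq
    using assms by metis
  then show ?thesis by blast
qed

lemma connectedin_reeb_quotient:
  fixes f :: "'a \<Rightarrow> real"
  shows "x \<in> topspace X \<Longrightarrow> connectedin X (reeb_quotient X f x)"
  using connectedin_connected_component_of[of "subtopology X (slab X f {f x})" x]
  by (simp add: reeb_quotient_eq_component connectedin_subtopology)

locale compact_reeb =
  fixes X :: "'a topology" and f :: "'a \<Rightarrow> real"
  assumes compact: "compact_space X" and Hausdorff: "Hausdorff_space X"
    and continuous: "continuous_map X euclideanreal f"
begin

lemma closedin_reeb_quotient:
  assumes "x \<in> topspace X"
  shows "closedin X (reeb_quotient X f x)"
  unfolding reeb_quotient_eq_component[OF assms]
  by (rule closedin_trans_full[OF closedin_connected_component_of closedin_slab[OF continuous closed_singleton]])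

lemma compact_reeb_space: "compact_space (reeb_space X f)"
  using continuous_map_reeb_quotient compact topspace_reeb_space_image
  by (metis compact_space_def image_compactin)

lemma continuous_reeb_map: "continuous_map (reeb_space X f) euclideanreal (reeb_map f)"
  by (rule continuous_map_reeb_map[OF continuous])

text \<open>A level set is compact, so its components are quasi-components; a clopen splitting of it
  extends to an open splitting of all nearby level sets.\<close>

lemma light_reeb_map:
  assumes "w \<in> topspace (reeb_space X f)" "z \<in> topspace (reeb_space X f)" "w \<noteq> z" "reeb_map f w = reeb_map f z"
  shows "\<exists>A B. openin (reeb_space X f) A \<and> openin (reeb_space X f) B \<and> w \<in> A \<and> z \<in> B \<and> A \<inter> B = {} \<and>
    slab (reeb_space X f) (reeb_map f) {reeb_map f w} \<subseteq> A \<union> B"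
proof -
  obtain x y where x: "x \<in> topspace X" "w = reeb_quotient X f x" and y: "y \<in> topspace X" "z = reeb_quotient X f y"
    using assms(1,2) unfolding topspace_reeb_space_image by blast
  define t where "t = f x"
  have t: "f y = t" "reeb_map f w = t" using assms(4) x y by (simp_all add: t_def reeb_map_reeb_quotient)
  define L where "L = slab X f {t}"
  have L: "closedin X L" unfolding L_def by (rule closedin_slab[OF continuous]) simp
  have xyL: "x \<in> L" "y \<in> L" using x y t by (auto simp: L_def slab_def t_def)
  have topL: "topspace (subtopology X L) = L" using closedin_subset[OF L] by auto
  have "\<not> connected_component_of (subtopology X L) x y"
    using assms(3) reeb_quotient_eq_iff[OF x(1) y(1), of f] x y t
    by (auto simp: reeb_rel_def L_def slab_def t_def)
  \<comment> \<open>This turns different components of the compact Hausdorff level set into a clopen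
    subset containing just one of \<open>x\<close>, \<open>y\<close>.\<close>
  moreover have "quasi_component_of (subtopology X L) x = connected_component_of (subtopology X L) x"
  proof -
    have "compact_space (subtopology X L)" using L compact by (simp add: closedin_compact_space compact_space_subtopology)
    moreover have "Hausdorff_space (subtopology X L)" using Hausdorff by (rule Hausdorff_space_subtopology)
    ultimately have "quasi_components_of (subtopology X L) = connected_components_of (subtopology X L)"
      by (intro quasi_eq_connected_components_of) simp
    then show ?thesis unfolding quasi_eq_connected_components_of_pointwise_alt by (rule spec)
  qed
  ultimately have "\<not> quasi_component_of (subtopology X L) x y" by simp
  then obtain T where T: "closedin (subtopology X L) T" "openin (subtopology X L) T" "(x \<in> T) \<noteq> (y \<in> T)"
    using xyL unfolding quasi_component_of_def topL by blast
  define T' where "T' = (if x \<in> T then T else L - T)"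
  have T': "closedin (subtopology X L) T'" "openin (subtopology X L) T'" "x \<in> T'" "y \<in> L - T'"
    using T xyL topL closedin_diff[OF closedin_topspace T(2)] openin_diff[OF openin_topspace T(1)]
    by (auto simp: T'_def)
  have "closedin X T'" using T'(1) L by (rule closedin_trans_full)
  moreover have "closedin X (L - T')"
    using closedin_diff[OF closedin_topspace T'(2)] L unfolding topL by (rule closedin_trans_full)
  moreover have "disjnt T' (L - T')" by (auto simp: disjnt_def)
  moreover have "normal_space X" using compact Hausdorff compact_Hausdorff_or_regular_imp_normal_space by blast
  ultimately obtain U V where UV: "openin X U" "openin X V" "T' \<subseteq> U" "L - T' \<subseteq> V" "disjnt U V"
    unfolding normal_space_def by meson
  have "slab X f {t} \<subseteq> U \<union> V" using UV by (auto simp: L_def)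
  then obtain d where d: "d > 0" "slab X f {t-d<..<t+d} \<subseteq> U \<union> V"
    using slab_tube[OF compact continuous openin_Un[OF UV(1,2)]] by metis
  define J where "J = slab X f {t-d<..<t+d}"
  have J: "openin X J" unfolding J_def by (rule openin_slab[OF continuous]) simp
  \<comment> \<open>A class in \<open>J\<close> is connected and covered by the disjoint open
    \<open>P\<close> and \<open>Q\<close>, so it cannot lie in both. Hence both parts of
    \<open>J\<close> are saturated and have open images; \<open>P\<close> and \<open>Q\<close> are
    variables because the fact is used in both orders.\<close>
  have sat: "u \<in> P" if PQ: "openin X P" "openin X Q" "disjnt P Q" "J \<subseteq> P \<union> Q"
      and u: "v \<in> P" "v \<in> J" "u \<in> topspace X" "reeb_quotient X f u = reeb_quotient X f v" for P Q u v
  proof -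
    have v: "v \<in> topspace X" using u by (auto simp: J_def slab_def)
    let ?C = "reeb_quotient X f v"
    have C: "connectedin X ?C" by (rule connectedin_reeb_quotient[OF v])
    have uv: "u \<in> ?C" "v \<in> ?C"
      using u v equiv_class_self[OF equiv_reeb_rel, of _ X f] unfolding reeb_quotient_def by metis+
    have "?C \<subseteq> J" using u(2) by (auto simp: J_def slab_def reeb_quotient_def reeb_rel_def)
    then show "u \<in> P" using connectedinD[OF C PQ(1,2)] PQ(3,4) uv u(1) unfolding disjnt_def by blast
  qed
  have J2: "u \<in> J \<longleftrightarrow> v \<in> J" if "reeb_quotient X f u = reeb_quotient X f v" "u \<in> topspace X" "v \<in> topspace X" for u v
    using that reeb_map_reeb_quotient[of _ X f] by (metis J_def slab_iff)
  have J_UV: "J \<subseteq> U \<union> V" "J \<subseteq> V \<union> U" using d by (auto simp: J_def)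
  define A where "A = reeb_quotient X f ` (U \<inter> J)"
  define B where "B = reeb_quotient X f ` (V \<inter> J)"
  have UVt: "U \<subseteq> topspace X" "V \<subseteq> topspace X" "J \<subseteq> topspace X" by (intro openin_subset UV J)+
  have "{u \<in> topspace X. reeb_quotient X f u \<in> A} = U \<inter> J"
    unfolding A_def using sat[OF UV(1,2,5) J_UV(1)] J2 UVt by blast
  then have "openin (reeb_space X f) A"
    unfolding reeb_space_def openin_quotient_topology using UV J UVt by (auto simp: A_def)
  moreover have "{u \<in> topspace X. reeb_quotient X f u \<in> B} = V \<inter> J"
    unfolding B_def using sat[OF UV(2,1) disjnt_sym[OF UV(5)] J_UV(2)] J2 UVt by blast
  then have "openin (reeb_space X f) B"
    unfolding reeb_space_def openin_quotient_topology using UV J UVt by (auto simp: B_def)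
  moreover have "A \<inter> B = {}"
  proof (rule ccontr)
    assume "A \<inter> B \<noteq> {}"
    then obtain u v where u: "u \<in> U" "u \<in> J" and v: "v \<in> V" "reeb_quotient X f v = reeb_quotient X f u"
      unfolding A_def B_def by fastforce
    then have "v \<in> U" using sat[OF UV(1,2,5) J_UV(1) u, of v] UVt by blast
    then show False using v UV(5) by (auto simp: disjnt_def)
  qed
  moreover have tJ: "u \<in> J" if "u \<in> L" for u using that d(1) by (auto simp: L_def J_def slab_def)
  moreover have "w \<in> A" "z \<in> B" using x y xyL tJ T'(3,4) UV(3,4) by (auto simp: A_def B_def)
  moreover have "slab (reeb_space X f) (reeb_map f) {t} \<subseteq> A \<union> B"
  proof
    fix v assume v: "v \<in> slab (reeb_space X f) (reeb_map f) {t}"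
    then obtain u where u: "u \<in> topspace X" "v = reeb_quotient X f u" by (auto simp: slab_iff topspace_reeb_space_image)
    then have "u \<in> L" using v by (simp add: L_def slab_iff reeb_map_reeb_quotient)
    then show "v \<in> A \<union> B" using tJ[of u] UV(3,4) u by (auto simp: A_def B_def)
  qed
  ultimately show ?thesis using t(2) by blast
qed

lemma Hausdorff_reeb_space: "Hausdorff_space (reeb_space X f)"
proof (rule Hausdorff_if_light[OF continuous_reeb_map])
  fix w z assume "w \<in> topspace (reeb_space X f)" "z \<in> topspace (reeb_space X f)" "w \<noteq> z" "reeb_map f w = reeb_map f z"
  from light_reeb_map[OF this]
  show "\<exists>A B. openin (reeb_space X f) A \<and> openin (reeb_space X f) B \<and> w \<in> A \<and> z \<in> B \<and> A \<inter> B = {}"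
    by (elim exE conjE) (intro exI conjI)
qed

text \<open>Being nearby-related on all close levels is an equivalence relation on the connected class of
  \<open>x\<close> with open classes, hence relates all its points.\<close>

lemma reeb_regular_class_nhd:
  assumes x: "x \<in> topspace X" and reg: "\<And>y. y \<in> topspace X \<Longrightarrow> f y = f x \<Longrightarrow> reeb_regular X f y"
  shows "\<exists>U d. openin X U \<and> reeb_quotient X f x \<subseteq> U \<and> d > 0 \<and>
    (\<forall>u\<in>U. \<forall>v\<in>U. f u = f v \<and> \<bar>f u - f x\<bar> < d \<longrightarrow> (u, v) \<in> reeb_rel X f)"
proof -
  define t where "t = f x"
  define C where "C = reeb_quotient X f x"
  have C: "closedin X C" "connectedin X C" "x \<in> C"
    using closedin_reeb_quotient[OF x] connectedin_reeb_quotient[OF x] equiv_class_self[OF equiv_reeb_rel x]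
    by (auto simp: C_def reeb_quotient_def)
  then have C': "C \<subseteq> topspace X" by (simp add: closedin_subset)
  have Cf: "f y = t" if "y \<in> C" for y using that by (auto simp: C_def reeb_quotient_def reeb_rel_def t_def)
  have R1: "\<exists>B. openin X B \<and> y \<in> B \<and> (\<forall>u\<in>B. \<forall>v\<in>B. f u = f v \<longrightarrow> (u, v) \<in> reeb_rel X f)" if "y \<in> C" for y
    using reg[of y] that C' Cf[OF that] unfolding reeb_regular_def t_def by blast
  have R2: "\<exists>d>0. {t - d<..<t + d} \<subseteq> f ` B" if "y \<in> C" "openin X B" "y \<in> B" for y B
    using reg[of y] that C' Cf[OF that(1)] unfolding reeb_regular_def t_def by (metis subsetD)
  define near where "near y By z Bz d \<longleftrightarrow> openin X By \<and> y \<in> By \<and> openin X Bz \<and> z \<in> Bz \<and> d > 0 \<and>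
    (\<forall>u\<in>By. \<forall>v\<in>Bz. f u = f v \<and> \<bar>f u - t\<bar> < d \<longrightarrow> (u, v) \<in> reeb_rel X f)" for y By z Bz and d :: real
  define rel where "rel y z \<longleftrightarrow> (\<exists>By Bz d. near y By z Bz d)" for y z
  \<comment> \<open>Openness of \<open>f\<close> at \<open>b\<close> supplies, on each level close
    to \<open>t\<close>, a point in both neighbourhoods of \<open>b\<close>, through which the two
    relations are chained.\<close>
  have rel_trans: "rel a c" if "rel a b" "rel b c" "b \<in> C" for a b c
  proof -
    obtain Ba Bb d where 1: "near a Ba b Bb d" using \<open>rel a b\<close> by (auto simp: rel_def)
    obtain Bb' Bc d' where 2: "near b Bb' c Bc d'" using \<open>rel b c\<close> by (auto simp: rel_def)
    have "openin X (Bb \<inter> Bb')" "b \<in> Bb \<inter> Bb'" using 1 2 by (auto simp: near_def)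
    then obtain e where e: "e > 0" "{t - e<..<t + e} \<subseteq> f ` (Bb \<inter> Bb')" using R2[OF \<open>b \<in> C\<close>] by blast
    have "(u, v) \<in> reeb_rel X f"
      if uv: "u \<in> Ba" "v \<in> Bc" "f u = f v" "\<bar>f u - t\<bar> < min e (min d d')" for u v
    proof -
      have "f u \<in> {t - e<..<t + e}" using uv(4) by (auto simp: abs_less_iff)
      then obtain m where m: "m \<in> Bb" "m \<in> Bb'" "f m = f u" using e(2) by fastforce
      have "(u, m) \<in> reeb_rel X f" "(m, v) \<in> reeb_rel X f"
        using 1 2 m uv unfolding near_def by auto
      then show ?thesis by (rule reeb_rel_trans)
    qed
    then have "near a Ba c Bc (min e (min d d'))" using 1 2 e by (auto simp: near_def)
    then show ?thesis by (auto simp: rel_def)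
  qed
  define D1 where "D1 = {y. rel x y}"
  \<comment> \<open>Neighbourhoods of the points of \<open>C\<close> unrelated to \<open>x\<close>.
    A point of \<open>C\<close> in both \<open>D1\<close> and \<open>D2\<close> would relate one of
    those to \<open>x\<close>; since \<open>C\<close> is connected and \<open>x\<close> is in
    \<open>D1\<close>, all of \<open>C\<close> lies in \<open>D1\<close>.\<close>
  define D2 where "D2 = \<Union>{B. openin X B \<and> (\<exists>y\<in>C. \<not> rel x y \<and> y \<in> B) \<and> (\<forall>u\<in>B. \<forall>v\<in>B. f u = f v \<longrightarrow> (u, v) \<in> reeb_rel X f)}"
  have "openin X D1"
  proof (subst openin_subopen, intro ballI)
    fix y assume "y \<in> D1"
    then obtain Bx By d where n: "near x Bx y By d" by (auto simp: D1_def rel_def)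
    then have "near x Bx y' By d" if "y' \<in> By" for y' using that by (auto simp: near_def)
    then have "By \<subseteq> D1" by (auto simp: D1_def rel_def)
    then show "\<exists>T. openin X T \<and> y \<in> T \<and> T \<subseteq> D1" using n by (auto simp: near_def)
  qed
  moreover have "openin X D2" by (auto simp: D2_def)
  moreover have "C \<subseteq> D1 \<union> D2"
  proof
    fix y assume "y \<in> C"
    then show "y \<in> D1 \<union> D2" using R1[of y] by (auto simp: D1_def D2_def)
  qed
  moreover have "D1 \<inter> D2 \<inter> C = {}"
  proof (rule ccontr)
    assume "D1 \<inter> D2 \<inter> C \<noteq> {}"
    then obtain y' where y': "y' \<in> D1" "y' \<in> D2" "y' \<in> C" by blast
    then obtain B y where B: "openin X B" "y \<in> C" "\<not> rel x y" "y \<in> B" "y' \<in> B"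
      "\<forall>u\<in>B. \<forall>v\<in>B. f u = f v \<longrightarrow> (u, v) \<in> reeb_rel X f" by (auto simp: D2_def)
    then have "near y' B y B 1" by (simp add: near_def)
    then have "rel y' y" by (auto simp: rel_def)
    then show False using rel_trans[of x y' y] y' B(3) by (simp add: D1_def)
  qed
  moreover have "x \<in> D1"
  proof -
    obtain B where "openin X B" "x \<in> B" "\<forall>u\<in>B. \<forall>v\<in>B. f u = f v \<longrightarrow> (u, v) \<in> reeb_rel X f"
      using R1[OF C(3)] by blast
    then have "near x B x B 1" by (simp add: near_def)
    then show ?thesis by (auto simp: D1_def rel_def)
  qed
  ultimately have "C \<subseteq> D1" using connectedinD[OF C(2), of D1 D2] C(3) by blast
  then have "\<forall>y\<in>C. \<exists>Bx By d. near x Bx y By d" by (auto simp: D1_def rel_def)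
  then obtain Bx By d where n: "\<And>y. y \<in> C \<Longrightarrow> near x (Bx y) y (By y) (d y)" by metis
  have "compactin X C" using compact C(1) by (rule closedin_compact_space)
  then obtain \<F> where F: "finite \<F>" "\<F> \<subseteq> By ` C" "C \<subseteq> \<Union>\<F>"
    using n compactinD[of X C "By ` C"] unfolding near_def by blast
  obtain T where T: "T \<subseteq> C" "finite T" "\<F> = By ` T" using F by (metis finite_subset_image)
  have Tn: "T \<noteq> {}" using F T C(3) by auto
  define U where "U = \<Union>\<F>"
  \<comment> \<open>A finite intersection is still a neighbourhood of \<open>x\<close>, so on each
    nearby level it contains a point \<open>b\<close>, which is related to every point of
    \<open>U\<close> on that level.\<close>
  define B where "B = (\<Inter>y\<in>T. Bx y)"
  have "openin X B" unfolding B_def using Tn T n by (intro openin_INT2) (auto simp: near_def)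
  moreover have "x \<in> B" using n T by (auto simp: B_def near_def)
  ultimately obtain e where e: "e > 0" "{t - e<..<t + e} \<subseteq> f ` B" using R2[OF C(3)] by blast
  define m where "m = Min (insert e (d ` T))"
  have m: "m > 0" "m \<le> e" "\<And>y. y \<in> T \<Longrightarrow> m \<le> d y"
    using T e n by (auto simp: m_def near_def)
  have "(u, v) \<in> reeb_rel X f" if uv: "u \<in> U" "v \<in> U" "f u = f v" "\<bar>f u - t\<bar> < m" for u v
  proof -
    have "f u \<in> {t - e<..<t + e}" using uv(4) m(2) by (auto simp: abs_less_iff)
    then obtain b where b: "b \<in> B" "f b = f u" using e(2) by fastforce
    have "(b, v') \<in> reeb_rel X f" if "v' \<in> U" "f v' = f u" for v'
    proof -
      obtain y where y: "y \<in> T" "v' \<in> By y" using \<open>v' \<in> U\<close> T by (auto simp: U_def)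
      then have "near x (Bx y) y (By y) (d y)" "b \<in> Bx y" "\<bar>f b - t\<bar> < d y"
        using n T(1) b uv(4) m(3)[OF y(1)] by (auto simp: B_def)
      then show ?thesis using y(2) b(2) that(2) unfolding near_def by metis
    qed
    then have "(b, u) \<in> reeb_rel X f" "(b, v) \<in> reeb_rel X f" using uv by auto
    then show ?thesis using reeb_rel_sym reeb_rel_trans by metis
  qed
  moreover have "openin X U" using T n by (auto simp: U_def near_def)
  ultimately show ?thesis using m(1) F(3) unfolding U_def C_def t_def by blast
qed

lemma tame_map_reeb_map:
  assumes S: "finite S" and reg: "\<And>x. x \<in> topspace X \<Longrightarrow> f x \<notin> S \<Longrightarrow> reeb_regular X f x"
    and cov: "finite \<Y>" "\<And>Y. Y \<in> \<Y> \<Longrightarrow> connectedin X Y" "topspace X \<subseteq> \<Union>\<Y>"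
  shows "tame_map (reeb_space X f) (reeb_map f) S"
proof
  let ?q = "reeb_quotient X f"
  show "finite S" "compact_space (reeb_space X f)" "continuous_map (reeb_space X f) euclideanreal (reeb_map f)"
    using S compact_reeb_space continuous_reeb_map by auto
  show "\<exists>A B. openin (reeb_space X f) A \<and> openin (reeb_space X f) B \<and> w \<in> A \<and> z \<in> B \<and> A \<inter> B = {} \<and>
      slab (reeb_space X f) (reeb_map f) {reeb_map f w} \<subseteq> A \<union> B"
    if "w \<in> topspace (reeb_space X f)" "z \<in> topspace (reeb_space X f)" "w \<noteq> z" "reeb_map f w = reeb_map f z" for w z
    by (rule light_reeb_map[OF that])
  show "\<exists>\<Y>. finite \<Y> \<and> (\<forall>Y\<in>\<Y>. connectedin (reeb_space X f) Y) \<and> topspace (reeb_space X f) \<subseteq> \<Union>\<Y>"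
  proof (intro exI[of _ "(\<lambda>Y. ?q ` Y) ` \<Y>"] conjI)
    show "\<forall>Y\<in>(\<lambda>Y. ?q ` Y) ` \<Y>. connectedin (reeb_space X f) Y"
      using cov(2) connectedin_continuous_map_image[OF continuous_map_reeb_quotient] by blast
    show "topspace (reeb_space X f) \<subseteq> \<Union>((\<lambda>Y. ?q ` Y) ` \<Y>)"
      using cov(3) unfolding topspace_reeb_space_image by blast
  qed (use cov in simp)
  show "\<exists>d>0. {reeb_map f w - d<..<reeb_map f w + d} \<subseteq> reeb_map f ` N"
    if N: "openin (reeb_space X f) N" "w \<in> N" "reeb_map f w \<notin> S" for N w
  proof -
    have "N \<subseteq> topspace (reeb_space X f)" using N(1) by (rule openin_subset)
    then obtain x where x: "x \<in> topspace X" "w = ?q x" using N(2) unfolding topspace_reeb_space_image by blast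
    define B where "B = {u \<in> topspace X. ?q u \<in> N}"
    have "openin X B" using N(1) unfolding reeb_space_def openin_quotient_topology B_def by blast
    moreover have "x \<in> B" "f x \<notin> S" "reeb_map f w = f x"
      using x N by (auto simp: B_def reeb_map_reeb_quotient)
    ultimately obtain d where d: "d > 0" "{f x - d<..<f x + d} \<subseteq> f ` B"
      using reg[OF x(1)] unfolding reeb_regular_def by blast
    have "f ` B \<subseteq> reeb_map f ` N"
    proof
      fix s assume "s \<in> f ` B"
      then obtain u where "u \<in> B" "s = f u" by blast
      then show "s \<in> reeb_map f ` N"
        by (intro image_eqI[of _ _ "?q u"]) (auto simp: B_def reeb_map_reeb_quotient)
    qed
    then show ?thesis using d \<open>reeb_map f w = f x\<close> by (metis subset_trans)
  qed
  show "\<exists>N. openin (reeb_space X f) N \<and> w \<in> N \<and> inj_on (reeb_map f) N"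
    if w: "w \<in> topspace (reeb_space X f)" "reeb_map f w \<notin> S" for w
  proof -
    obtain x where x: "x \<in> topspace X" "w = ?q x" using w unfolding topspace_reeb_space_image by blast
    then have fx: "reeb_map f w = f x" "f x \<notin> S" using w by (auto simp: reeb_map_reeb_quotient)
    then obtain U d where U: "openin X U" "?q x \<subseteq> U" "d > 0"
      "\<forall>u\<in>U. \<forall>v\<in>U. f u = f v \<and> \<bar>f u - f x\<bar> < d \<longrightarrow> (u, v) \<in> reeb_rel X f"
      using reeb_regular_class_nhd[OF x(1)] reg by metis
    \<comment> \<open>\<open>U\<close> need not be saturated, so \<open>N\<close> takes only the
      classes lying entirely in \<open>U\<close>; they form an open set because the quotient map is
      closed.\<close>
    define N where "N = (topspace (reeb_space X f) - ?q ` (topspace X - U)) \<inter> slab (reeb_space X f) (reeb_map f) {f x - d<..<f x + d}"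
    have "closed_map X (reeb_space X f) ?q"
      by (rule continuous_imp_closed_map_gen[OF compact _ continuous_map_reeb_quotient])
        (rule Hausdorff_imp_kc_space[OF Hausdorff_reeb_space])
    then have "closedin (reeb_space X f) (?q ` (topspace X - U))" using U(1) by (auto simp: closed_map_def)
    then have "openin (reeb_space X f) N"
      unfolding N_def by (intro openin_Int openin_diff openin_slab continuous_reeb_map) auto
    moreover have "w \<in> N"
    proof -
      have "?q u \<noteq> w" if "u \<in> topspace X - U" for u
        using that U(2) x(2) equiv_class_self[OF equiv_reeb_rel, of u X f]
        unfolding reeb_quotient_def by blast
      then show ?thesis using w(1) fx(1) U(3) by (auto simp: N_def slab_iff)
    qed
    moreover have "inj_on (reeb_map f) N"
    proof (rule inj_onI)
      fix a b assume ab: "a \<in> N" "b \<in> N" "reeb_map f a = reeb_map f b"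
      then obtain u v where u: "u \<in> topspace X" "a = ?q u" and v: "v \<in> topspace X" "b = ?q v"
        unfolding N_def topspace_reeb_space_image by blast
      have "u \<in> U" "v \<in> U" using ab u v by (auto simp: N_def)
      moreover have "f u = f v" using ab u v by (simp add: reeb_map_reeb_quotient)
      moreover have "\<bar>f u - f x\<bar> < d" using ab(1) u by (auto simp: N_def slab_iff reeb_map_reeb_quotient)
      ultimately have "(u, v) \<in> reeb_rel X f" using U(4) by blast
      then show "a = b" using reeb_quotient_eq_iff u v by metis
    qed
    ultimately show ?thesis by blast
  qed
qed

end

section \<open>Level sets near a point with nonzero derivative\<close>

text \<open>One fixed direction with positive derivative on a whole ball reduces the local analysis
  to one-variable calculus on lines parallel to \<open>v\<close>.\<close>

locale transversal_direction =
  fixes g :: "'e::euclidean_space \<Rightarrow> real" and z v :: 'e and R :: real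
  assumes R: "R > 0" and v: "norm v = 1"
    and diff: "\<And>y. y \<in> cball z R \<Longrightarrow> g differentiable (at y)"
    and pos: "\<And>y. y \<in> cball z R \<Longrightarrow> frechet_derivative g (at y) v > 0"
begin

lemma along_line:
  assumes ab: "a \<le> b" "y + a *\<^sub>R v \<in> cball z R" "y + b *\<^sub>R v \<in> cball z R" and t: "a \<le> t" "t \<le> b"
  shows "((\<lambda>t. g (y + t *\<^sub>R v)) has_real_derivative frechet_derivative g (at (y + t *\<^sub>R v)) v) (at t)"
    and "frechet_derivative g (at (y + t *\<^sub>R v)) v > 0"
proof -
  have "y + t *\<^sub>R v \<in> closed_segment (y + a *\<^sub>R v) (y + b *\<^sub>R v)"
  proof (cases "a = b")
    case False
    define s where "s = (t - a) / (b - a)"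
    have "s * (b - a) = t - a" using False by (simp add: s_def)
    then have "t = (1 - s) * a + s * b" by (simp add: algebra_simps)
    moreover have "0 \<le> s" "s \<le> 1" using False ab(1) t by (auto simp: s_def)
    ultimately have s: "0 \<le> s" "s \<le> 1" "t = (1 - s) * a + s * b" by simp_all
    have "y + t *\<^sub>R v = (1 - s) *\<^sub>R (y + a *\<^sub>R v) + s *\<^sub>R (y + b *\<^sub>R v)"
      unfolding s(3) by (simp add: algebra_simps)
    then show ?thesis using s by (auto simp: in_segment)
  qed (use t in auto)
  then have *: "y + t *\<^sub>R v \<in> cball z R"
    using closed_segment_subset[OF ab(2,3) convex_cball] by blast
  then show "frechet_derivative g (at (y + t *\<^sub>R v)) v > 0" by (rule pos)
  have G: "(g has_derivative frechet_derivative g (at (y + t *\<^sub>R v))) (at (y + t *\<^sub>R v))"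
    using diff[OF *] frechet_derivative_works by blast
  have L: "((\<lambda>t. y + t *\<^sub>R v) has_derivative (\<lambda>s. s *\<^sub>R v)) (at t)"
    by (auto intro!: derivative_eq_intros)
  show "((\<lambda>t. g (y + t *\<^sub>R v)) has_real_derivative frechet_derivative g (at (y + t *\<^sub>R v)) v) (at t)"
    using has_derivative_compose[OF L G] linear_scale[OF has_derivative_linear[OF G]]
    by (intro has_derivative_imp_has_field_derivative) auto
qed

lemma increasing:
  assumes "a < b" "y + a *\<^sub>R v \<in> cball z R" "y + b *\<^sub>R v \<in> cball z R"
  shows "g (y + a *\<^sub>R v) < g (y + b *\<^sub>R v)"
proof (rule DERIV_pos_imp_increasing[OF assms(1)])
  show "\<exists>D. ((\<lambda>t. g (y + t *\<^sub>R v)) has_real_derivative D) (at t) \<and> 0 < D" if "a \<le> t" "t \<le> b" for t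
    using along_line[OF _ assms(2,3) that] assms(1) by auto
qed

lemma intermediate:
  assumes "a \<le> b" "y + a *\<^sub>R v \<in> cball z R" "y + b *\<^sub>R v \<in> cball z R"
    "g (y + a *\<^sub>R v) \<le> s" "s \<le> g (y + b *\<^sub>R v)"
  shows "\<exists>t. a \<le> t \<and> t \<le> b \<and> g (y + t *\<^sub>R v) = s"
proof (rule IVT'[where f = "\<lambda>t. g (y + t *\<^sub>R v)", OF assms(4,5,1)])
  show "continuous_on {a..b} (\<lambda>t. g (y + t *\<^sub>R v))"
    using along_line(1)[OF assms(1-3)]
    by (intro continuous_at_imp_continuous_on ballI) (meson DERIV_isCont atLeastAtMost_iff)
qed

lemma z_plus: "\<bar>t\<bar> \<le> R \<Longrightarrow> z + t *\<^sub>R v \<in> cball z R"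
  using v by (simp add: dist_norm)

text \<open>Along the line through \<open>z\<close> the values pass strictly from below
  \<open>g z\<close> to above it, and the intermediate value theorem fills in the rest.\<close>

lemma open_image:
  assumes "open B" "z \<in> B"
  shows "\<exists>d>0. {g z - d<..<g z + d} \<subseteq> g ` B"
proof -
  obtain e where e: "e > 0" "cball z e \<subseteq> B" using assms open_contains_cball by blast
  define r where "r = min e R"
  have r: "r > 0" "r \<le> e" "r \<le> R" using e R by (auto simp: r_def)
  have in_cball: "z + (-r) *\<^sub>R v \<in> cball z R" "z + r *\<^sub>R v \<in> cball z R" "z + 0 *\<^sub>R v \<in> cball z R"
    by (intro z_plus; use r R in simp)+
  have lt: "g (z + (-r) *\<^sub>R v) < g z" "g z < g (z + r *\<^sub>R v)"
    using increasing[OF _ in_cball(1,3)] increasing[OF _ in_cball(3,2)] r by auto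
  define d where "d = min (g z - g (z + (-r) *\<^sub>R v)) (g (z + r *\<^sub>R v) - g z)"
  have "s \<in> g ` B" if "s \<in> {g z - d<..<g z + d}" for s
  proof -
    have "g (z + (-r) *\<^sub>R v) \<le> s" "s \<le> g (z + r *\<^sub>R v)" using that by (auto simp: d_def min_def split: if_splits)
    then obtain t where t: "-r \<le> t" "t \<le> r" "g (z + t *\<^sub>R v) = s"
      using intermediate[OF _ in_cball(1,2)] r by fastforce
    then have "z + t *\<^sub>R v \<in> cball z e" using v r by (simp add: dist_norm)
    then show ?thesis using t e by blast
  qed
  moreover have "d > 0" using lt by (simp add: d_def)
  ultimately show ?thesis by blast
qed

text \<open>In a cylinder with axis \<open>v\<close>, orthogonal projection maps each level close to
  \<open>g z\<close> bijectively onto a disc: injective by monotonicity, onto by intermediate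
  values. By compactness it is a homeomorphism, and the disc is convex.\<close>

lemma connected_levels:
  "\<exists>B. open B \<and> z \<in> B \<and> B \<subseteq> cball z R \<and>
    (\<forall>s. \<exists>Z. connected Z \<and> Z \<subseteq> {y \<in> cball z R. g y = s} \<and> {y \<in> B. g y = s} \<subseteq> Z)"
proof -
  have cont: "continuous_on (cball z R) g"
    using diff differentiable_imp_continuous_within continuous_at_imp_continuous_on by blast
  \<comment> \<open>A cylinder of half-height \<open>\<rho>\<close> and radius at most
    \<open>\<rho>\<close> fits into \<open>cball z R\<close>.\<close>
  define \<rho> where "\<rho> = R / 2"
  have \<rho>: "\<rho> > 0" "\<rho> < R" using R by (auto simp: \<rho>_def)
  have ends: "z + \<rho> *\<^sub>R v \<in> cball z R" "z + (-\<rho>) *\<^sub>R v \<in> cball z R" "z + 0 *\<^sub>R v \<in> cball z R"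
    by (intro z_plus; use \<rho> R in simp)+
  \<comment> \<open>Half of the smaller change along the axis: values within \<open>e\<close> of
    those at the two axis ends still lie above \<open>g z + e\<close> and below
    \<open>g z - e\<close>.\<close>
  define e where "e = min (g (z + \<rho> *\<^sub>R v) - g z) (g z - g (z + (-\<rho>) *\<^sub>R v)) / 2"
  have e: "e > 0" using increasing[OF _ ends(2,3)] increasing[OF _ ends(3,1)] \<rho> by (auto simp: e_def)
  have ee: "g (z + \<rho> *\<^sub>R v) \<ge> g z + 2 * e" "g (z + (-\<rho>) *\<^sub>R v) \<le> g z - 2 * e" by (auto simp: e_def min_def field_simps)
  obtain r1 where r1: "r1 > 0" "\<And>y. y \<in> cball z R \<Longrightarrow> dist y (z + \<rho> *\<^sub>R v) < r1 \<Longrightarrow> dist (g y) (g (z + \<rho> *\<^sub>R v)) < e"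
    using cont ends(1) e unfolding continuous_on_iff by metis
  obtain r2 where r2: "r2 > 0" "\<And>y. y \<in> cball z R \<Longrightarrow> dist y (z + (-\<rho>) *\<^sub>R v) < r2 \<Longrightarrow> dist (g y) (g (z + (-\<rho>) *\<^sub>R v)) < e"
    using cont ends(2) e unfolding continuous_on_iff by metis
  define r where "r = min \<rho> (min r1 r2 / 2)"
  have r: "r > 0" "r \<le> \<rho>" "r < r1" "r < r2" using \<rho> r1 r2 by (auto simp: r_def min_def)
  define h where "h y = (y - z) \<bullet> v" for y
  define \<pi> where "\<pi> y = (y - z) - h y *\<^sub>R v" for y
  have vv: "v \<bullet> v = 1" using v by (simp add: norm_eq_1)
  have decomp: "y = z + \<pi> y + h y *\<^sub>R v" for y by (simp add: \<pi>_def)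
  have \<pi>v: "\<pi> y \<bullet> v = 0" for y by (simp add: \<pi>_def h_def inner_diff_left vv)
  have hu: "h (z + u + t *\<^sub>R v) = t" "\<pi> (z + u + t *\<^sub>R v) = u" if "u \<bullet> v = 0" for u t
    using that by (simp_all add: \<pi>_def h_def inner_add_left vv)
  have cont_h: "continuous_on T h" "continuous_on T \<pi>" for T
    unfolding \<pi>_def h_def by (intro continuous_intros)+
  define D where "D = {u. u \<bullet> v = 0} \<inter> cball 0 r"
  have in_ball: "z + u + t *\<^sub>R v \<in> cball z R" if "norm u \<le> r" "\<bar>t\<bar> \<le> \<rho>" for u t
  proof -
    have "norm (u + t *\<^sub>R v) \<le> norm u + norm (t *\<^sub>R v)" by (rule norm_triangle_ineq)
    also have "\<dots> \<le> \<rho> + \<rho>" using that r(2) v by auto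
    finally have "norm (u + t *\<^sub>R v) \<le> R" by (simp add: \<rho>_def)
    moreover have "dist z (z + u + t *\<^sub>R v) = norm (u + t *\<^sub>R v)"
      by (metis add.assoc add_diff_cancel_left' dist_commute dist_norm)
    ultimately show ?thesis by simp
  qed
  define P where "P = \<pi> -` cball 0 r \<inter> h -` {-\<rho>..\<rho>}"
  have P_ball: "P \<subseteq> cball z R"
  proof
    fix y assume "y \<in> P"
    then have "z + \<pi> y + h y *\<^sub>R v \<in> cball z R" by (intro in_ball) (auto simp: P_def)
    then show "y \<in> cball z R" by (simp flip: decomp)
  qed
  have "closed P" unfolding P_def
    by (intro closed_Int closed_vimage cont_h) auto
  then have "compact P" using P_ball bounded_cball bounded_subset compact_eq_bounded_closed by blast
  define K where "K s = {y \<in> P. g y = s}" for s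
  have Kc: "compact (K s)" for s
  proof -
    have "closedin (top_of_set P) (P \<inter> g -` {s})"
      by (rule continuous_closedin_preimage[OF continuous_on_subset[OF cont P_ball]]) simp
    moreover have "K s = P \<inter> g -` {s}" by (auto simp: K_def)
    ultimately show ?thesis using \<open>compact P\<close> closedin_compact by metis
  qed
  have inj: "inj_on \<pi> (K s)" for s
  proof (rule inj_onI)
    fix x y assume xy: "x \<in> K s" "y \<in> K s" "\<pi> x = \<pi> y"
    define w where "w = z + \<pi> x"
    have x: "x = w + h x *\<^sub>R v" and y: "y = w + h y *\<^sub>R v" using decomp[of x] decomp[of y] xy by (auto simp: w_def)
    have "x \<in> cball z R" "y \<in> cball z R" "g x = g y" using xy P_ball by (auto simp: K_def)
    then have "\<not> h x < h y" "\<not> h y < h x"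
      using increasing[of "h x" "h y" w] increasing[of "h y" "h x" w] x y by auto
    then show "x = y" using x y by (metis linorder_neqE)
  qed
  have img: "\<pi> ` K s = D" if s: "\<bar>s - g z\<bar> < e" for s
  proof
    show "\<pi> ` K s \<subseteq> D" using \<pi>v by (auto simp: D_def K_def P_def)
    show "D \<subseteq> \<pi> ` K s"
    proof
      fix u assume u: "u \<in> D"
      then have ur: "norm u \<le> r" "u \<bullet> v = 0" by (auto simp: D_def)
      have c: "z + u + \<rho> *\<^sub>R v \<in> cball z R" "z + u + (-\<rho>) *\<^sub>R v \<in> cball z R"
        by (intro in_ball; use ur \<rho> in simp)+
      have "dist (g (z + u + \<rho> *\<^sub>R v)) (g (z + \<rho> *\<^sub>R v)) < e"
        by (rule r1(2)[OF c(1)]) (use ur r in \<open>simp add: dist_norm\<close>)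
      moreover have "dist (g (z + u + (-\<rho>) *\<^sub>R v)) (g (z + (-\<rho>) *\<^sub>R v)) < e"
        by (rule r2(2)[OF c(2)]) (use ur r in \<open>simp add: dist_norm\<close>)
      ultimately have "g (z + u + (-\<rho>) *\<^sub>R v) \<le> s" "s \<le> g (z + u + \<rho> *\<^sub>R v)"
        using s ee unfolding dist_real_def by linarith+
      then obtain t where t: "-\<rho> \<le> t" "t \<le> \<rho>" "g (z + u + t *\<^sub>R v) = s"
        using intermediate[OF _ c(2,1)] \<rho> by fastforce
      then have "z + u + t *\<^sub>R v \<in> K s" using ur hu[OF ur(2), of t] by (auto simp: K_def P_def)
      then show "u \<in> \<pi> ` K s" using hu(2)[OF ur(2), of t] by (metis image_eqI)
    qed
  qed
  have conn: "connected (K s)" if s: "\<bar>s - g z\<bar> < e" for s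
  proof -
    obtain k where k: "homeomorphism (K s) D \<pi> k"
      using homeomorphism_compact[OF Kc cont_h(2) img[OF s] inj] by blast
    have "convex D" unfolding D_def
      by (intro convex_Int convex_cball) (auto simp: convex_def inner_add_left)
    then show ?thesis using k unfolding homeomorphism_def by (metis connected_continuous_image convex_connected)
  qed
  \<comment> \<open>Cutting down to values within \<open>e\<close> of \<open>g z\<close> removes all
    levels for which \<open>K s\<close> is not known to be connected.\<close>
  define B where "B = ball z r \<inter> g -` {g z - e<..<g z + e}"
  have ballR: "ball z r \<subseteq> cball z R" using r(2) \<rho> by (auto simp: subset_iff)
  have "open B" unfolding B_def
    by (rule continuous_open_preimage[OF continuous_on_subset[OF cont ballR]]) auto
  moreover have "z \<in> B" using r e by (auto simp: B_def)
  moreover have "B \<subseteq> cball z R" using ballR by (auto simp: B_def)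
  moreover have "\<exists>Z. connected Z \<and> Z \<subseteq> {y \<in> cball z R. g y = s} \<and> {y \<in> B. g y = s} \<subseteq> Z" for s
  proof (cases "\<bar>s - g z\<bar> < e")
    case True
    have "{y \<in> B. g y = s} \<subseteq> K s"
    proof
      fix y assume "y \<in> {y \<in> B. g y = s}"
      then have y: "norm (y - z) < r" "g y = s" by (auto simp: B_def dist_norm norm_minus_commute)
      have "\<bar>h y\<bar> \<le> norm (y - z)" unfolding h_def using Cauchy_Schwarz_ineq2[of "y - z" v] v by simp
      moreover have "norm (\<pi> y) \<le> norm (y - z)"
      proof (rule norm_le[THEN iffD2])
        have "(w - (w \<bullet> v) *\<^sub>R v) \<bullet> (w - (w \<bullet> v) *\<^sub>R v) = w \<bullet> w - (w \<bullet> v)\<^sup>2" for w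
          by (simp add: inner_diff_left inner_diff_right vv inner_commute power2_eq_square)
        then show "\<pi> y \<bullet> \<pi> y \<le> (y - z) \<bullet> (y - z)" by (simp add: \<pi>_def h_def)
      qed
      ultimately show "y \<in> K s" using y r(2) by (auto simp: K_def P_def)
    qed
    then show ?thesis using conn[OF True] P_ball by (intro exI[of _ "K s"]) (auto simp: K_def)
  next
    case False
    then have "{y \<in> B. g y = s} = {}" by (auto simp: B_def abs_less_iff)
    then show ?thesis by (intro exI[of _ "{}"]) auto
  qed
  ultimately show ?thesis by blast
qed

end

text \<open>A vector with nonzero derivative is normalised and given the right sign; continuity of
  the first derivative spreads positivity to a ball.\<close>

lemma transversal_direction_exists:
  fixes g :: "'e::euclidean_space \<Rightarrow> real"
  assumes U: "open U" "z \<in> U" and sm: "smooth_on U g" and nc: "\<not> (g has_derivative (\<lambda>_. 0)) (at z)"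
  shows "\<exists>v R. transversal_direction g z v R \<and> cball z R \<subseteq> U"
proof -
  have "Ck_on (Suc 0) U g" using sm by (simp only: smooth_on_def)
  then have diff: "\<And>x. x \<in> U \<Longrightarrow> g differentiable (at x)"
    and cont: "\<And>v. continuous_on U (\<lambda>x. frechet_derivative g (at x) v)" by auto
  define D where "D = frechet_derivative g (at z)"
  have D: "(g has_derivative D) (at z)" using diff[OF U(2)] frechet_derivative_works unfolding D_def by blast
  then have lin: "linear D" by (rule has_derivative_linear)
  have "D \<noteq> (\<lambda>_. 0)" using D nc by auto
  then obtain w where w: "D w \<noteq> 0" by blast
  then have w0: "w \<noteq> 0" using linear_0[OF lin] by auto
  define v where "v = (sgn (D w) / norm w) *\<^sub>R w"
  have v: "norm v = 1" using w w0 by (simp add: v_def abs_sgn_eq)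
  have "D v = (sgn (D w) / norm w) * D w" unfolding v_def by (simp add: linear_scale[OF lin])
  also have "\<dots> = \<bar>D w\<bar> / norm w" by (simp add: abs_sgn mult.commute)
  finally have Dv: "D v > 0" using w w0 by simp
  have "open (U \<inter> (\<lambda>x. frechet_derivative g (at x) v) -` {0<..})"
    by (rule continuous_open_preimage[OF cont U(1)]) simp
  moreover have "z \<in> U \<inter> (\<lambda>x. frechet_derivative g (at x) v) -` {0<..}" using U Dv by (simp add: D_def)
  ultimately obtain R where R: "R > 0" "cball z R \<subseteq> U \<inter> (\<lambda>x. frechet_derivative g (at x) v) -` {0<..}"
    using open_contains_cball by blast
  then have "transversal_direction g z v R"
    using v diff by unfold_locales auto
  then show ?thesis using R by blast
qed

section \<open>Smooth functions on closed manifolds\<close>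

lemma smooth_on_imp_continuous_on: "smooth_on U g \<Longrightarrow> continuous_on U g"
  unfolding smooth_on_def by (metis Ck_on.simps(1))

lemma euclidean_chart_inverse:
  assumes "euclidean_chart X (U, \<phi>)"
  shows "openin X U" "open (\<phi> ` U)" "U \<subseteq> topspace X"
    "continuous_map (subtopology X U) (top_of_set (\<phi> ` U)) \<phi>"
    "continuous_map (top_of_set (\<phi> ` U)) (subtopology X U) (inv_into U \<phi>)"
    "\<And>x. x \<in> U \<Longrightarrow> inv_into U \<phi> (\<phi> x) = x"
    "homeomorphic_map (top_of_set (\<phi> ` U)) (subtopology X U) (inv_into U \<phi>)"
proof -
  show U: "openin X U" "open (\<phi> ` U)" using assms by (auto simp: euclidean_chart_def)
  then show Us: "U \<subseteq> topspace X" by (simp add: openin_subset)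
  have hm: "homeomorphic_map (subtopology X U) (top_of_set (\<phi> ` U)) \<phi>"
    using assms by (auto simp: euclidean_chart_def)
  then show "continuous_map (subtopology X U) (top_of_set (\<phi> ` U)) \<phi>" by (rule homeomorphic_imp_continuous_map)
  have top: "topspace (subtopology X U) = U" using Us by auto
  have inj: "inj_on \<phi> U" using homeomorphic_imp_injective_map[OF hm] top by simp
  then show inv: "inv_into U \<phi> (\<phi> x) = x" if "x \<in> U" for x using that by simp
  obtain g where g: "homeomorphic_maps (subtopology X U) (top_of_set (\<phi> ` U)) \<phi> g"
    using hm homeomorphic_map_maps by blast
  have "g y = inv_into U \<phi> y" if "y \<in> \<phi> ` U" for y
    using that inv g unfolding homeomorphic_maps_def top by auto
  moreover have gh: "homeomorphic_map (top_of_set (\<phi> ` U)) (subtopology X U) g"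
    using g homeomorphic_maps_map homeomorphic_maps_sym by blast
  ultimately show "homeomorphic_map (top_of_set (\<phi> ` U)) (subtopology X U) (inv_into U \<phi>)"
    using homeomorphic_map_eq[OF gh] by simp
  then show "continuous_map (top_of_set (\<phi> ` U)) (subtopology X U) (inv_into U \<phi>)"
    by (rule homeomorphic_imp_continuous_map)
qed

lemma chart_image_open:
  assumes "euclidean_chart X (U, \<phi>)" "open B" "B \<subseteq> \<phi> ` U"
  shows "openin X (inv_into U \<phi> ` B)"
proof -
  note c = euclidean_chart_inverse[OF assms(1)]
  have "openin (top_of_set (\<phi> ` U)) B" using assms(2,3) by (simp add: open_subset)
  then have "openin (subtopology X U) (inv_into U \<phi> ` B)"
    using homeomorphic_imp_open_map[OF c(7)] by (simp add: open_map_def)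
  then show ?thesis using c(1) by (rule openin_trans_full)
qed

lemma chart_image_connected:
  assumes "euclidean_chart X (U, \<phi>)" "connected Z" "Z \<subseteq> \<phi> ` U"
  shows "connectedin X (inv_into U \<phi> ` Z)"
proof -
  note c = euclidean_chart_inverse[OF assms(1)]
  have "connectedin (top_of_set (\<phi> ` U)) Z" using assms(2,3) by (simp add: connectedin_subtopology)
  then have "connectedin (subtopology X U) (inv_into U \<phi> ` Z)" by (rule connectedin_continuous_map_image[OF c(5)])
  then show ?thesis by (simp add: connectedin_subtopology)
qed

lemma continuous_map_smooth_function:
  assumes M: "smooth_manifold X A" and f: "smooth_function A f"
  shows "continuous_map X euclideanreal f"
proof (rule pasting_lemma[where I = A and T = fst and f = "\<lambda>_. f"])
  fix c assume c: "c \<in> A"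
  obtain U \<phi> where U: "c = (U, \<phi>)" by (cases c)
  have ch: "euclidean_chart X (U, \<phi>)" using M c U by (auto simp: smooth_manifold_def)
  note i = euclidean_chart_inverse[OF ch]
  show "openin X (fst c)" using i(1) U by simp
  have "continuous_on (\<phi> ` U) (f \<circ> inv_into U \<phi>)"
    by (rule smooth_on_imp_continuous_on) (use f c U in \<open>auto simp: smooth_function_def\<close>)
  then have "continuous_map (top_of_set (\<phi> ` U)) euclideanreal (f \<circ> inv_into U \<phi>)" by simp
  then have "continuous_map (subtopology X U) euclideanreal ((f \<circ> inv_into U \<phi>) \<circ> \<phi>)"
    by (rule continuous_map_compose[OF i(4)])
  then have "continuous_map (subtopology X U) euclideanreal f"
    by (rule continuous_map_eq) (use i(6) in auto)
  then show "continuous_map (subtopology X (fst c)) euclideanreal f" using U by simp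
next
  fix x assume "x \<in> topspace X"
  then show "\<exists>j. j \<in> A \<and> x \<in> fst j \<and> f x = f x" using M by (fastforce simp: smooth_manifold_def)
qed auto

lemma reeb_regular_if_not_critical:
  assumes M: "smooth_manifold X A" and f: "smooth_function A f"
    and x: "x \<in> topspace X" and nc: "x \<notin> critical_points A f"
  shows "reeb_regular X f x"
proof -
  obtain U \<phi> where U: "(U, \<phi>) \<in> A" "x \<in> U" using M x by (force simp: smooth_manifold_def)
  have ch: "euclidean_chart X (U, \<phi>)" using M U by (auto simp: smooth_manifold_def)
  note i = euclidean_chart_inverse[OF ch]
  define \<psi> where "\<psi> = inv_into U \<phi>"
  define g where "g = f \<circ> \<psi>"
  define z where "z = \<phi> x"
  have gf: "g (\<phi> y) = f y" if "y \<in> U" for y using i(6)[OF that] by (simp add: g_def \<psi>_def)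
  have z: "z \<in> \<phi> ` U" "g z = f x" "\<psi> z = x" using U(2) gf i(6) by (auto simp: z_def \<psi>_def)
  have "smooth_on (\<phi> ` U) g" using f U(1) by (auto simp: smooth_function_def g_def \<psi>_def)
  \<comment> \<open>\<open>critical_points\<close> asks for some chart with zero derivative, so at a
    noncritical point the derivative is nonzero in every chart.\<close>
  moreover have "\<not> (g has_derivative (\<lambda>_. 0)) (at z)"
    using nc U unfolding critical_points_def g_def z_def \<psi>_def by blast
  ultimately obtain v R where vR: "transversal_direction g z v R" "cball z R \<subseteq> \<phi> ` U"
    using transversal_direction_exists[OF i(2) z(1)] by blast
  interpret transversal_direction g z v R by (rule vR(1))
  obtain B where B: "open B" "z \<in> B" "B \<subseteq> cball z R"
    "\<And>s. \<exists>Z. connected Z \<and> Z \<subseteq> {y \<in> cball z R. g y = s} \<and> {y \<in> B. g y = s} \<subseteq> Z"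
    using connected_levels by blast
  have rel: "(a, b) \<in> reeb_rel X f" if ab: "a \<in> \<psi> ` B" "b \<in> \<psi> ` B" "f a = f b" for a b
  proof -
    obtain a' b' where a': "a' \<in> B" "a = \<psi> a'" and b': "b' \<in> B" "b = \<psi> b'" using ab by blast
    obtain Z where Z: "connected Z" "Z \<subseteq> {y \<in> cball z R. g y = f a}" "{y \<in> B. g y = f a} \<subseteq> Z"
      using B(4) by blast
    have "connectedin X (\<psi> ` Z)"
      unfolding \<psi>_def by (rule chart_image_connected[OF ch Z(1)]) (use Z(2) vR(2) in blast)
    moreover have "f y = f a" if "y \<in> \<psi> ` Z" for y using that Z(2) by (auto simp: g_def)
    moreover have "a \<in> \<psi> ` Z" "b \<in> \<psi> ` Z" using a' b' ab(3) Z(3) by (auto simp: g_def)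
    ultimately show ?thesis by (rule reeb_relI)
  qed
  have \<psi>B: "openin X (\<psi> ` B)"
    unfolding \<psi>_def by (rule chart_image_open[OF ch B(1)]) (use B(3) vR(2) in blast)
  have x\<psi>B: "x \<in> \<psi> ` B" using B(2) z(3) by force
  have "\<exists>d>0. {f x - d<..<f x + d} \<subseteq> f ` T" if T: "openin X T" "x \<in> T" for T
  proof -
    have "openin (top_of_set (\<phi> ` U)) {y \<in> \<phi> ` U. \<psi> y \<in> T \<inter> U}"
      using openin_continuous_map_preimage[OF i(5), of "T \<inter> U"] T(1) by (simp add: openin_subtopology_Int \<psi>_def)
    then have "open {y \<in> \<phi> ` U. \<psi> y \<in> T \<inter> U}" using i(2) by (metis openin_open_eq)
    moreover have "z \<in> {y \<in> \<phi> ` U. \<psi> y \<in> T \<inter> U}" using z T U by auto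
    ultimately obtain d where d: "d > 0" "{g z - d<..<g z + d} \<subseteq> g ` {y \<in> \<phi> ` U. \<psi> y \<in> T \<inter> U}"
      using open_image by blast
    have "g ` {y \<in> \<phi> ` U. \<psi> y \<in> T \<inter> U} \<subseteq> f ` T" by (auto simp: g_def)
    then show ?thesis using d z(2) by (metis subset_trans)
  qed
  then show ?thesis
    unfolding reeb_regular_def using rel \<psi>B x\<psi>B by (intro conjI exI[of _ "\<psi> ` B"]) simp_all
qed

text \<open>Coordinate balls are open and connected; compactness selects finitely many.\<close>

lemma finite_connected_cover:
  assumes M: "smooth_manifold X A" and "compact_space X"
  obtains \<Y> where "finite \<Y>" "\<And>Y. Y \<in> \<Y> \<Longrightarrow> connectedin X Y" "topspace X \<subseteq> \<Union>\<Y>"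
proof -
  define \<C> where "\<C> = {Y. openin X Y \<and> connectedin X Y}"
  have "topspace X \<subseteq> \<Union>\<C>"
  proof
    fix x assume "x \<in> topspace X"
    then obtain U \<phi> where U: "(U, \<phi>) \<in> A" "x \<in> U" using M by (force simp: smooth_manifold_def)
    have ch: "euclidean_chart X (U, \<phi>)" using M U by (auto simp: smooth_manifold_def)
    note i = euclidean_chart_inverse[OF ch]
    obtain r where r: "r > 0" "ball (\<phi> x) r \<subseteq> \<phi> ` U" using i(2) U(2) open_contains_ball by blast
    have "openin X (inv_into U \<phi> ` ball (\<phi> x) r)" by (rule chart_image_open[OF ch _ r(2)]) simp
    moreover have "connectedin X (inv_into U \<phi> ` ball (\<phi> x) r)" by (rule chart_image_connected[OF ch _ r(2)]) simp
    moreover have "x \<in> inv_into U \<phi> ` ball (\<phi> x) r"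
      by (rule image_eqI[of _ _ "\<phi> x"]) (use i(6)[OF U(2)] r(1) in auto)
    ultimately show "x \<in> \<Union>\<C>" by (auto simp: \<C>_def)
  qed
  moreover have "openin X Y" if "Y \<in> \<C>" for Y using that by (simp add: \<C>_def)
  ultimately obtain \<F> where "finite \<F>" "\<F> \<subseteq> \<C>" "topspace X \<subseteq> \<Union>\<F>"
    using assms(2)[unfolded compact_space_alt, rule_format, of \<C>] by blast
  then show thesis by (intro that[of \<F>]) (auto simp: \<C>_def)
qed

theorem theorem3p1:
  fixes X :: "'a topology"
    and A :: "('a, 'e::euclidean_space) chart set"
    and f :: "'a \<Rightarrow> real"
  assumes "smooth_closed_manifold X A"
    and "DIM('e) \<ge> 2"
    and "smooth_function A f"
    and "finite (critical_values A f)"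
  shows "\<exists>V G. graph_structure (reeb_space X f) V G \<and>
           (\<forall>e\<in>edges G. embedding_map (subtopology (reeb_space X f) e) euclideanreal (reeb_map f))"
proof -
  have M: "smooth_manifold X A" "compact_space X" "Hausdorff_space X"
    using assms(1) by (auto simp: smooth_closed_manifold_def smooth_manifold_def)
  interpret compact_reeb X f
    using M continuous_map_smooth_function[OF M(1) assms(3)] by unfold_locales
  obtain \<Y> where \<Y>: "finite \<Y>" "\<And>Y. Y \<in> \<Y> \<Longrightarrow> connectedin X Y" "topspace X \<subseteq> \<Union>\<Y>"
    using finite_connected_cover[OF M(1,2)] by blast
  \<comment> \<open>A level that is not a critical value contains no critical point, so regularity
    holds along the whole fibre, as \<open>reeb_regular_class_nhd\<close> requires.\<close>
  have "reeb_regular X f x" if "x \<in> topspace X" "f x \<notin> critical_values A f" for x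
    using reeb_regular_if_not_critical[OF M(1) assms(3) that(1)] that(2) by (auto simp: critical_values_def)
  then interpret tame_map "reeb_space X f" "reeb_map f" "critical_values A f"
    using assms(4) \<Y> by (intro tame_map_reeb_map) auto
  show ?thesis by (rule graph_structure_edges_embedded)
qed

end
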